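(* Suppose $\mathcal B$ is a normal $\mathfrak q_n^+$-crystal. Then there exists a unique action of the group $W_n^{\mathsf{BC}}$ on the set $\mathcal B$ in which $t_0$ and $t_i$ for $i\in[n-1]$ act as the operators $\sigma_0$ and $\sigma_i$, respectively.
   Context: **Group.** $n$ is a positive integer. $W_n^{\mathsf{BC}}$ is the group of permutations $w$ of $\mathbb Z$ with $w(-i)=-w(i)$ for all $i\in\mathbb Z$ and $w(i)=i$ for all $i>n$; this is the finite Coxeter group of type $\mathsf{BC}_n$ with simple generators $t_0=(-1,1)$ and $t_i=(i,i+1)(-i,-i-1)$ for $i\in[n-1]$. **Operators $\sigma_i$.** For a $\mathfrak q_n^+$-crystal $\mathcal B$ and $i\in\{0\}\cup[n-1]$, $\sigma_i:\mathcal B\to\mathcal B$ is defined by $\sigma_i(b)=f_i^k(b)$ if $k\ge0$ and $\sigma_i(b)=e_i^{-k}(b)$ if $k\le0$, where $k=\varphi_i(b)-\varepsilon_i(b)$. **Notation.** $\mathbb N=\{0,1,2,\dots\}$, $[k]=\{1,\dots,k\}$, $[p,q]=\{i\in\mathbb Z:p\le i\le q\}$; $\mathbf e_1,\dots,\mathbf e_n$ is the standard basis of $\mathbb Z^n$. **Crystals.** All crystals are nonempty sets $\mathcal B$ with a weight map $\mathrm{wt}:\mathcal B\to\mathbb Z^n$ and raising/lowering operators $e_i,f_i:\mathcal B\to\mathcal B\sqcup\{0\}$, where $0\notin\mathcal B$ is an auxiliary element (operators send $0$ to $0$). Put $\varepsilon_i(b)=\max\{k\in\mathbb N:e_i^k(b)\ne0\}$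 and $\varphi_i(b)=\max\{k\in\mathbb N:f_i^k(b)\ne0\}$ in $\mathbb N\sqcup\{\infty\}$. A *$\mathfrak{gl}_n$-crystal* has operators indexed by $i\in[n-1]$ such that for all $b,c\in\mathcal B$ and $i\in[n-1]$: (S1) $e_i(b)=c$ iff $f_i(c)=b$, in which case $\mathrm{wt}(c)-\mathrm{wt}(b)=\mathbf e_i-\mathbf e_{i+1}$; (S2) $\varepsilon_i(b),\varphi_i(b)$ are finite and $\varphi_i(b)-\varepsilon_i(b)=\mathrm{wt}(b)_i-\mathrm{wt}(b)_{i+1}$. For $n\ge2$, a *$\mathfrak q_n$-crystal* is a $\mathfrak{gl}_n$-crystal with $\mathrm{wt}(\mathcal B)\subset\mathbb N^n$ and additional operators $e_{\bar1},f_{\bar1}$ such that for all $b,c\in\mathcal B$: (P1) $e_{\bar1}(b)=c$ iff $f_{\bar1}(c)=b$, in which case $\mathrm{wt}(c)-\mathrm{wt}(b)=\mathbf e_1-\mathbf e_2$ and $\varepsilon_i(b)=\varepsilon_i(c)$, $\varphi_i(b)=\varphi_i(c)$ for $i\in[3,n-1]$; (P2) for $i\in[3,n-1]$, $e_i,f_i$ commute with $e_{\bar1},f_{\bar1}$; (P3) $(\varepsilon_{\bar1}+\varphi_{\bar1})(b)=0$ if $\mathrm{wt}(b)_1=\mathrm{wt}(b)_2=0$, and $=1$ otherwise. A *$\mathfrak q_1$-crystal* is a nonempty set with a map $\mathrm{wt}:\mathcal B\to\mathbb N$. A *$\mathfrak q_n^+$-crystal* is a $\mathfrak q_n$-crystal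 with additional operators $e_0,f_0$ such that for all $b,c\in\mathcal B$: (Q1) $e_0(b)=c$ iff $f_0(c)=b$, in which case $\mathrm{wt}(b)=\mathrm{wt}(c)$ and $\varepsilon_i(b)=\varepsilon_i(c)$, $\varphi_i(b)=\varphi_i(c)$ for all $i\in[n-1]$ and also for $i=\bar1$ if $n\ge2$; (Q2) for $i\in[2,n-1]$, $e_i,f_i$ commute with $e_0,f_0$; (Q3) $(\varepsilon_0+\varphi_0)(b)=0$ if $\mathrm{wt}(b)_1=0$, and $=1$ otherwise. The *crystal graph* has vertex set $\mathcal B$ and an edge $b\xrightarrow{i}c$ whenever $f_i(b)=c\neq0$. The weakly connected components of this graph, with inherited structure, are the *full subcrystals*. An *isomorphism* is a weight-preserving bijection giving an isomorphism of labeled crystal graphs. **Tensor product.** For $\mathfrak q_n^+$-crystals $\mathcal B,\mathcal C$, the set $\mathcal B\otimes\mathcal C=\{b\otimes c\}$ is a $\mathfrak q_n^+$-crystal with $\mathrm{wt}(b\otimes c)=\mathrm{wt}(b)+\mathrm{wt}(c)$ and (with $b\otimes0=0\otimes c=0$) the following operators. For $i\in[n-1]$: $e_i(b\otimes c)=b\otimes e_i(c)$ if $\varepsilon_i(b)\le\varphi_i(c)$, else $e_i(b)\otimes c$; $f_i(b\otimes c)=b\otimes f_i(c)$ if $\varepsilon_i(b)<\varphi_i(c)$, else $f_i(b)\otimes c$. For $g\in\{e_0,f_0\}$: $g(b\otimes c)=g(b)\otimes c$ if $\mathrm{wt}(b)_1\ne0$, else $b\otimes g(c)$. If $n\ge2$: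 $e_{\bar1}(b\otimes c)$ equals $b\otimes e_{\bar1}(c)$ if $\mathrm{wt}(b)_1=\mathrm{wt}(b)_2=0$; $f_0e_{\bar1}(b)\otimes e_0(c)$ if $\mathrm{wt}(b)_1=0$, $f_0e_{\bar1}(b)\ne0$, $e_0(c)\neq0$; $e_0e_{\bar1}(b)\otimes f_0(c)$ if $\mathrm{wt}(b)_1=0$, $e_0e_{\bar1}(b)\neq0$, $f_0(c)\ne0$; and $e_{\bar1}(b)\otimes c$ otherwise. And $f_{\bar1}(b\otimes c)$ equals $b\otimes f_{\bar1}(c)$ if $\mathrm{wt}(b)_1=\mathrm{wt}(b)_2=0$; $f_{\bar1}f_0(b)\otimes e_0(c)$ if $\mathrm{wt}(b)_1=1$, $f_{\bar1}f_0(b)\ne0$, $e_0(c)\ne0$; $f_{\bar1}e_0(b)\otimes f_0(c)$ if $\mathrm{wt}(b)_1=1$, $f_{\bar1}e_0(b)\ne0$, $f_0(c)\neq0$; and $f_{\bar1}(b)\otimes c$ otherwise. This tensor product is associative. **Normal crystals.** The *standard $\mathfrak q_n^+$-crystal* $\mathbb B_n^+$ has $2n$ elements $\boxed{i},\boxed{i'}$ ($i\in[n]$), both of weight $\mathbf e_i$, with $f_i:\boxed{i}\mapsto\boxed{i+1}$, $\boxed{i'}\mapsto\boxed{(i+1)'}$ for $i\in[n-1]$; $f_{\bar1}:\boxed1\mapsto\boxed2$, $\boxed{1'}\mapsto\boxed{2'}$ (if $n\ge2$); $f_0:\boxed1\mapsto\boxed{1'}$; all other values of the $f$'s are $0$,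 and the $e$'s are the partial inverses. $(\mathbb B_n^+)^{\otimes0}$ is the one-element crystal of weight $0$. A $\mathfrak q_n^+$-crystal is *normal* if each of its full subcrystals is isomorphic to a full subcrystal of $(\mathbb B_n^+)^{\otimes m}$ for some $m\in\mathbb N$. *)

theory Defs
  imports "HOL-Algebra.Group_Action" "HOL-Combinatorics.Transposition" "HOL-Library.Extended_Nat"
begin

section \<open>Crystal data\<close>

text \<open>The indices $0, 1, 2, \dots$ are \<open>Op i\<close>, the index $\bar 1$ is \<open>Bar1\<close>.\<close>

datatype crystal_index = Op nat | Bar1

definition gl_indices :: "nat \<Rightarrow> crystal_index set"
  where "gl_indices n = Op ` {1..<n}"

definition q_indices :: "nat \<Rightarrow> crystal_index set"
  where "q_indices n = gl_indices n \<union> (if 2 \<le> n then {Bar1} else {})"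

definition q_plus_indices :: "nat \<Rightarrow> crystal_index set"
  where "q_plus_indices n = insert (Op 0) (q_indices n)"

text \<open>
  The auxiliary element $0$ is \<open>None\<close>. A weight in $\mathbb{Z}^n$ is a function
  \<open>nat \<Rightarrow> int\<close> vanishing outside \<open>{1..n}\<close>. All fields are total
  functions; only their values on the carrier, and at the indices of the kind of crystal
  under consideration (\<open>gl_indices n\<close>, \<open>q_indices n\<close> or
  \<open>q_plus_indices n\<close>), are meaningful.
\<close>

record 'b crystal = "'b partial_object" +
  wt :: "'b \<Rightarrow> nat \<Rightarrow> int"
  raise :: "crystal_index \<Rightarrow> 'b \<Rightarrow> 'b option"
  lower :: "crystal_index \<Rightarrow> 'b \<Rightarrow> 'b option"

definition unit_weight :: "nat \<Rightarrow> nat \<Rightarrow> int"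
  where "unit_weight i = (\<lambda>k. if k = i then 1 else 0)"

definition op_power :: "('b \<Rightarrow> 'b option) \<Rightarrow> nat \<Rightarrow> 'b \<Rightarrow> 'b option"
  where "op_power g k b = ((\<lambda>x. Option.bind x g) ^^ k) (Some b)"

text \<open>A supremum in \<open>enat\<close> is the maximum if that exists, and $\infty$ if the set is infinite.\<close>

definition string_length :: "('b \<Rightarrow> 'b option) \<Rightarrow> 'b \<Rightarrow> enat"
  where "string_length g b = (SUP k\<in>{k. op_power g k b \<noteq> None}. enat k)"

definition crystal_eps :: "'b crystal \<Rightarrow> crystal_index \<Rightarrow> 'b \<Rightarrow> enat"
  where "crystal_eps C i = string_length (raise C i)"

definition crystal_phi :: "'b crystal \<Rightarrow> crystal_index \<Rightarrow> 'b \<Rightarrow> enat"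
  where "crystal_phi C i = string_length (lower C i)"

definition ops_commute_at :: "('b \<Rightarrow> 'b option) \<Rightarrow> ('b \<Rightarrow> 'b option) \<Rightarrow> 'b \<Rightarrow> bool"
  where "ops_commute_at g h b \<longleftrightarrow> Option.bind (h b) g = Option.bind (g b) h"


section \<open>Axioms\<close>

locale gl_crystal =
  fixes n :: nat and C :: "'b crystal"
  assumes nonempty: "carrier C \<noteq> {}"
    and wt_support: "\<lbrakk>b \<in> carrier C; k \<notin> {1..n}\<rbrakk> \<Longrightarrow> wt C b k = 0"
    and gl_raise_closed:
      "\<lbrakk>i \<in> {1..<n}; b \<in> carrier C; raise C (Op i) b = Some c\<rbrakk> \<Longrightarrow> c \<in> carrier C"
    and gl_lower_closed:
      "\<lbrakk>i \<in> {1..<n}; b \<in> carrier C; lower C (Op i) b = Some c\<rbrakk> \<Longrightarrow> c \<in> carrier C"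
    and S1_inverse:
      "\<lbrakk>i \<in> {1..<n}; b \<in> carrier C; c \<in> carrier C\<rbrakk> \<Longrightarrow>
        raise C (Op i) b = Some c \<longleftrightarrow> lower C (Op i) c = Some b"
    and S1_wt:
      "\<lbrakk>i \<in> {1..<n}; b \<in> carrier C; c \<in> carrier C; raise C (Op i) b = Some c\<rbrakk> \<Longrightarrow>
        wt C c k - wt C b k = unit_weight i k - unit_weight (i + 1) k"
    and S2_finite:
      "\<lbrakk>i \<in> {1..<n}; b \<in> carrier C\<rbrakk> \<Longrightarrow>
        crystal_eps C (Op i) b \<noteq> \<infinity> \<and> crystal_phi C (Op i) b \<noteq> \<infinity>"
    and S2_wt:
      "\<lbrakk>i \<in> {1..<n}; b \<in> carrier C\<rbrakk> \<Longrightarrow>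
        int (the_enat (crystal_phi C (Op i) b)) - int (the_enat (crystal_eps C (Op i) b)) =
          wt C b i - wt C b (i + 1)"

locale q_crystal = gl_crystal +
  assumes wt_nonneg: "b \<in> carrier C \<Longrightarrow> 0 \<le> wt C b k"
    and bar_raise_closed:
      "\<lbrakk>2 \<le> n; b \<in> carrier C; raise C Bar1 b = Some c\<rbrakk> \<Longrightarrow> c \<in> carrier C"
    and bar_lower_closed:
      "\<lbrakk>2 \<le> n; b \<in> carrier C; lower C Bar1 b = Some c\<rbrakk> \<Longrightarrow> c \<in> carrier C"
    and P1_inverse:
      "\<lbrakk>2 \<le> n; b \<in> carrier C; c \<in> carrier C\<rbrakk> \<Longrightarrow>
        raise C Bar1 b = Some c \<longleftrightarrow> lower C Bar1 c = Some b"
    and P1_wt: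
      "\<lbrakk>2 \<le> n; b \<in> carrier C; c \<in> carrier C; raise C Bar1 b = Some c\<rbrakk> \<Longrightarrow>
        wt C c k - wt C b k = unit_weight 1 k - unit_weight 2 k"
    and P1_strings:
      "\<lbrakk>2 \<le> n; b \<in> carrier C; c \<in> carrier C; raise C Bar1 b = Some c; i \<in> {3..<n}\<rbrakk> \<Longrightarrow>
        crystal_eps C (Op i) b = crystal_eps C (Op i) c \<and>
        crystal_phi C (Op i) b = crystal_phi C (Op i) c"
    and P2:
      "\<lbrakk>2 \<le> n; i \<in> {3..<n}; b \<in> carrier C;
        g \<in> {raise C (Op i), lower C (Op i)}; h \<in> {raise C Bar1, lower C Bar1}\<rbrakk> \<Longrightarrow>
        ops_commute_at g h b"
    and P3:
      "\<lbrakk>2 \<le> n; b \<in> carrier C\<rbrakk> \<Longrightarrow>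
        crystal_eps C Bar1 b + crystal_phi C Bar1 b =
          (if wt C b 1 = 0 \<and> wt C b 2 = 0 then 0 else 1)"

locale q_plus_crystal = q_crystal +
  assumes zero_raise_closed:
      "\<lbrakk>b \<in> carrier C; raise C (Op 0) b = Some c\<rbrakk> \<Longrightarrow> c \<in> carrier C"
    and zero_lower_closed:
      "\<lbrakk>b \<in> carrier C; lower C (Op 0) b = Some c\<rbrakk> \<Longrightarrow> c \<in> carrier C"
    and Q1_inverse:
      "\<lbrakk>b \<in> carrier C; c \<in> carrier C\<rbrakk> \<Longrightarrow>
        raise C (Op 0) b = Some c \<longleftrightarrow> lower C (Op 0) c = Some b"
    and Q1_wt:
      "\<lbrakk>b \<in> carrier C; c \<in> carrier C; raise C (Op 0) b = Some c\<rbrakk> \<Longrightarrow> wt C b k = wt C c k"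
    and Q1_strings:
      "\<lbrakk>b \<in> carrier C; c \<in> carrier C; raise C (Op 0) b = Some c; j \<in> q_indices n\<rbrakk> \<Longrightarrow>
        crystal_eps C j b = crystal_eps C j c \<and> crystal_phi C j b = crystal_phi C j c"
    and Q2:
      "\<lbrakk>i \<in> {2..<n}; b \<in> carrier C;
        g \<in> {raise C (Op i), lower C (Op i)}; h \<in> {raise C (Op 0), lower C (Op 0)}\<rbrakk> \<Longrightarrow>
        ops_commute_at g h b"
    and Q3:
      "b \<in> carrier C \<Longrightarrow>
        crystal_eps C (Op 0) b + crystal_phi C (Op 0) b = (if wt C b 1 = 0 then 0 else 1)"


section \<open>Full subcrystals and isomorphisms\<close>

definition crystal_edge :: "'b crystal \<Rightarrow> crystal_index \<Rightarrow> 'b \<Rightarrow> 'b \<Rightarrow> bool"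
  where "crystal_edge C i b c \<longleftrightarrow>
    b \<in> carrier C \<and> c \<in> carrier C \<and> lower C i b = Some c"

definition full_subcrystals :: "nat \<Rightarrow> 'b crystal \<Rightarrow> 'b crystal set"
  where "full_subcrystals n C =
    {C\<lparr>carrier := {c. equivclp (\<lambda>x y. \<exists>i\<in>q_plus_indices n. crystal_edge C i x y) b c}\<rparr>
      | b. b \<in> carrier C}"

definition crystal_isomorphism :: "nat \<Rightarrow> 'b crystal \<Rightarrow> 'c crystal \<Rightarrow> ('b \<Rightarrow> 'c) \<Rightarrow> bool"
  where "crystal_isomorphism n B C f \<longleftrightarrow>
    bij_betw f (carrier B) (carrier C) \<and>
    (\<forall>b\<in>carrier B. wt C (f b) = wt B b) \<and>
    (\<forall>i\<in>q_plus_indices n. \<forall>b\<in>carrier B. \<forall>c\<in>carrier B.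
      crystal_edge B i b c \<longleftrightarrow> crystal_edge C i (f b) (f c))"


section \<open>Tensor products\<close>

text \<open>The convention $b \otimes 0 = 0 \otimes c = 0$.\<close>

definition opt_tensor :: "'b option \<Rightarrow> 'c option \<Rightarrow> ('b \<times> 'c) option"
  where "opt_tensor x y = Option.bind x (\<lambda>b. map_option (Pair b) y)"

text \<open>
  Composites are written as Kleisli composites, e.g.\ $f_0 e_{\bar 1}(b)$ is
  \<open>Option.bind (raise B Bar1 b) (lower B (Op 0))\<close>.
\<close>

fun tensor_raise ::
  "'b crystal \<Rightarrow> 'c crystal \<Rightarrow> crystal_index \<Rightarrow> 'b \<times> 'c \<Rightarrow> ('b \<times> 'c) option"
where
  "tensor_raise B C (Op i) (b, c) =
    (if i = 0 then
       (if wt B b 1 \<noteq> 0 then opt_tensor (raise B (Op 0) b) (Some c)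
        else opt_tensor (Some b) (raise C (Op 0) c))
     else
       (if crystal_eps B (Op i) b \<le> crystal_phi C (Op i) c
        then opt_tensor (Some b) (raise C (Op i) c)
        else opt_tensor (raise B (Op i) b) (Some c)))"
| "tensor_raise B C Bar1 (b, c) =
    (let f0e = Option.bind (raise B Bar1 b) (lower B (Op 0));
         e0e = Option.bind (raise B Bar1 b) (raise B (Op 0))
     in
       if wt B b 1 = 0 \<and> wt B b 2 = 0 then opt_tensor (Some b) (raise C Bar1 c)
       else if wt B b 1 = 0 \<and> f0e \<noteq> None \<and> raise C (Op 0) c \<noteq> None
         then opt_tensor f0e (raise C (Op 0) c)
       else if wt B b 1 = 0 \<and> e0e \<noteq> None \<and> lower C (Op 0) c \<noteq> None
         then opt_tensor e0e (lower C (Op 0) c)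
       else opt_tensor (raise B Bar1 b) (Some c))"

fun tensor_lower ::
  "'b crystal \<Rightarrow> 'c crystal \<Rightarrow> crystal_index \<Rightarrow> 'b \<times> 'c \<Rightarrow> ('b \<times> 'c) option"
where
  "tensor_lower B C (Op i) (b, c) =
    (if i = 0 then
       (if wt B b 1 \<noteq> 0 then opt_tensor (lower B (Op 0) b) (Some c)
        else opt_tensor (Some b) (lower C (Op 0) c))
     else
       (if crystal_eps B (Op i) b < crystal_phi C (Op i) c
        then opt_tensor (Some b) (lower C (Op i) c)
        else opt_tensor (lower B (Op i) b) (Some c)))"
| "tensor_lower B C Bar1 (b, c) =
    (let ff0 = Option.bind (lower B (Op 0) b) (lower B Bar1);
         fe0 = Option.bind (raise B (Op 0) b) (lower B Bar1)
     in
       if wt B b 1 = 0 \<and> wt B b 2 = 0 then opt_tensor (Some b) (lower C Bar1 c)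
       else if wt B b 1 = 1 \<and> ff0 \<noteq> None \<and> raise C (Op 0) c \<noteq> None
         then opt_tensor ff0 (raise C (Op 0) c)
       else if wt B b 1 = 1 \<and> fe0 \<noteq> None \<and> lower C (Op 0) c \<noteq> None
         then opt_tensor fe0 (lower C (Op 0) c)
       else opt_tensor (lower B Bar1 b) (Some c))"

definition tensor :: "'b crystal \<Rightarrow> 'c crystal \<Rightarrow> ('b \<times> 'c) crystal"
  where "tensor B C =
    \<lparr>carrier = carrier B \<times> carrier C,
     wt = (\<lambda>(b, c) k. wt B b k + wt C c k),
     raise = tensor_raise B C,
     lower = tensor_lower B C\<rparr>"

text \<open>Transport of structure along a map that is injective on the carrier.\<close>

definition relabel :: "('b \<Rightarrow> 'c) \<Rightarrow> 'b crystal \<Rightarrow> 'c crystal"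
  where "relabel f C =
    \<lparr>carrier = f ` carrier C,
     wt = (\<lambda>y. wt C (inv_into (carrier C) f y)),
     raise = (\<lambda>i y. map_option f (raise C i (inv_into (carrier C) f y))),
     lower = (\<lambda>i y. map_option f (lower C i (inv_into (carrier C) f y)))\<rparr>"

text \<open>
  The pure tensor $b_1 \otimes \cdots \otimes b_m$ is the list \<open>[b\<^sub>1, \<dots>, b\<^sub>m]\<close>; by
  associativity of the tensor product the bracketing from the right is immaterial.
\<close>

primrec tensor_power :: "'b crystal \<Rightarrow> nat \<Rightarrow> 'b list crystal"
where
  "tensor_power C 0 =
    \<lparr>carrier = {[]}, wt = (\<lambda>_ _. 0), raise = (\<lambda>_ _. None), lower = (\<lambda>_ _. None)\<rparr>"
| "tensor_power C (Suc m) = relabel (\<lambda>(b, w). b # w) (tensor C (tensor_power C m))"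


section \<open>Normal crystals\<close>

datatype box = Box nat | Box' nat

fun box_lower :: "crystal_index \<Rightarrow> box \<Rightarrow> box option"
where
  "box_lower (Op i) (Box j) =
    (if i = 0 then (if j = 1 then Some (Box' 1) else None)
     else (if j = i then Some (Box (i + 1)) else None))"
| "box_lower (Op i) (Box' j) = (if i \<noteq> 0 \<and> j = i then Some (Box' (i + 1)) else None)"
| "box_lower Bar1 (Box j) = (if j = 1 then Some (Box 2) else None)"
| "box_lower Bar1 (Box' j) = (if j = 1 then Some (Box' 2) else None)"

fun box_raise :: "crystal_index \<Rightarrow> box \<Rightarrow> box option"
where
  "box_raise (Op i) (Box j) = (if i \<noteq> 0 \<and> j = i + 1 then Some (Box i) else None)"
| "box_raise (Op i) (Box' j) =
    (if i = 0 then (if j = 1 then Some (Box 1) else None)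
     else (if j = i + 1 then Some (Box' i) else None))"
| "box_raise Bar1 (Box j) = (if j = 2 then Some (Box 1) else None)"
| "box_raise Bar1 (Box' j) = (if j = 2 then Some (Box' 1) else None)"

definition standard_crystal :: "nat \<Rightarrow> box crystal"
  where "standard_crystal n =
    \<lparr>carrier = Box ` {1..n} \<union> Box' ` {1..n},
     wt = (\<lambda>x. case x of Box i \<Rightarrow> unit_weight i | Box' i \<Rightarrow> unit_weight i),
     raise = box_raise,
     lower = box_lower\<rparr>"

definition normal_q_plus_crystal :: "nat \<Rightarrow> 'b crystal \<Rightarrow> bool"
  where "normal_q_plus_crystal n C \<longleftrightarrow>
    q_plus_crystal n C \<and>
    (\<forall>X\<in>full_subcrystals n C. \<exists>m.
      \<exists>Y\<in>full_subcrystals n (tensor_power (standard_crystal n) m).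
        \<exists>f. crystal_isomorphism n X Y f)"


section \<open>The operators $\sigma_i$ and the hyperoctahedral group\<close>

definition sigma :: "'b crystal \<Rightarrow> crystal_index \<Rightarrow> 'b \<Rightarrow> 'b"
  where "sigma C i b =
    (let k = int (the_enat (crystal_phi C i b)) - int (the_enat (crystal_eps C i b))
     in if 0 \<le> k then the (op_power (lower C i) (nat k) b)
        else the (op_power (raise C i) (nat (- k)) b))"

definition W_BC :: "nat \<Rightarrow> (int \<Rightarrow> int) monoid"
  where "W_BC n =
    \<lparr>carrier = {w. bij w \<and> (\<forall>i. w (- i) = - w i) \<and> (\<forall>i. int n < i \<longrightarrow> w i = i)},
     mult = (\<circ>),
     one = id\<rparr>"

definition BC_gen :: "nat \<Rightarrow> int \<Rightarrow> int"
  where "BC_gen i =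
    (if i = 0 then Transposition.transpose (- 1) 1
     else Transposition.transpose (int i) (int i + 1) \<circ> Transposition.transpose (- int i) (- int i - 1))"

end

theory Submission
  imports Defs
begin

text \<open>
  Write a word of boxes as a pair \<open>(U, P)\<close>: the word \<open>U\<close> of its values and the word
  \<open>P\<close> of Booleans that records which boxes are primed. For \<open>i \<ge> 1\<close> the tensor product
  rule looks only at values, so $\sigma_i$ acts on \<open>U\<close> as the Lascoux--Schuetzenberger
  involution and leaves \<open>P\<close> alone (\<open>box_reflect_pos\<close>). The operator $\sigma_0$ leaves
  \<open>U\<close> alone and toggles \<open>P\<close> at the position of the first \<open>1\<close> in \<open>U\<close>
  (\<open>box_reflect_0\<close>). Two toggles at positions read off from \<open>U\<close> commute, and
  $\sigma_1 \sigma_0 \sigma_1$ is such a toggle. Hence $\sigma_0$ and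
  $\sigma_1 \sigma_0 \sigma_1$ commute, which is the relation $(\sigma_0 \sigma_1)^4 = 1$. For
  $i \ge 2$ the operator $\sigma_i$ does not move the letters \<open>1\<close>, so it commutes with
  $\sigma_0$.

  The substantial relation is the braid relation of $\sigma_i$ and $\sigma_{i+1}$ on words of
  values. Only the letters $i, i+1, i+2$ matter, so it is a statement about words in three
  letters. Relations between words that respect the crystal operators and determine the left
  word from the right one transport the braid relation from right to left
  (\<open>braid_at_local_move\<close>). With additional letters for the columns of height two, such
  local moves bring every word to the column reading word of a semistandard tableau, that is, to
  columns 12, 13, 23 followed by letters 1, 2, 3, each in weakly increasing order
  (\<open>irreducible_normal\<close>). There both involutions are explicit piecewise linear maps in
  the six multiplicities, and the braid relation is a computation (\<open>braid_at_normal\<close>).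

  Every element of a normal crystal lies in a component that is isomorphic to a component of
  words of boxes, and the isomorphism intertwines the operators; so the relations hold in every
  normal crystal (\<open>sigma_relations\<close>). Finally the relations suffice for an action
  (\<open>action_depends_only_on_permutation\<close>): they rewrite every word in the generators as a
  distinguished coset word followed by a word in one generator fewer, and the coset is visible in
  the signed permutation as the image of the largest letter. The generators generate the group, so
  the action is unique.
\<close>

section \<open>Strings and their reflection\<close>

text \<open>
  A crystal with a single pair of operators, all of whose strings are finite, on a whole type.
  The string lengths are given as data, since for words they have a simple recursion that the
  suprema in \<open>string_length\<close> hide.
\<close>
locale string_crystal =
  fixes up down :: "'a \<Rightarrow> 'a option" and eps phi :: "'a \<Rightarrow> nat"
  assumes up_iff_down: "up b = Some a \<longleftrightarrow> down a = Some b"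
    and down_None_iff: "down a = None \<longleftrightarrow> phi a = 0"
    and up_None_iff: "up a = None \<longleftrightarrow> eps a = 0"
    and phi_down: "down a = Some b \<Longrightarrow> phi a = Suc (phi b)"
    and eps_down: "down a = Some b \<Longrightarrow> eps b = Suc (eps a)"
begin

lemma opposite: "string_crystal down up phi eps"
proof
  show "down b = Some a \<longleftrightarrow> up a = Some b" for a b
    using up_iff_down by blast
qed (use up_iff_down down_None_iff up_None_iff phi_down eps_down in blast)+

end

text \<open>
  The operator $\sigma$ for an arbitrary pair of operators. It mirrors an element in its string.
\<close>
definition reflect :: "('a \<Rightarrow> 'a option) \<Rightarrow> ('a \<Rightarrow> 'a option) \<Rightarrow> 'a \<Rightarrow> 'a"
  where "reflect up down b =
    (let k = int (the_enat (string_length down b)) - int (the_enat (string_length up b))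
     in if 0 \<le> k then the (op_power down (nat k) b) else the (op_power up (nat (- k)) b))"

lemma sigma_eq_reflect: "sigma C i = reflect (raise C i) (lower C i)"
  by (simp add: fun_eq_iff sigma_def reflect_def crystal_eps_def crystal_phi_def)

lemma op_power_0 [simp]: "op_power g 0 b = Some b"
  by (simp add: op_power_def)

lemma op_power_Suc: "op_power g (Suc k) b = Option.bind (op_power g k b) g"
  by (simp add: op_power_def)

lemma op_power_Suc': "op_power g (Suc k) b = Option.bind (g b) (op_power g k)"
proof (induction k)
  case (Suc k)
  show ?case
    by (subst op_power_Suc, subst Suc.IH) (cases "g b"; simp add: op_power_Suc)
qed (simp add: op_power_Suc)

lemma op_power_add: "op_power g (k + l) x = Option.bind (op_power g k x) (op_power g l)"
proof (induction k arbitrary: x)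
  case (Suc k)
  then show ?case by (cases "g x") (simp_all add: op_power_Suc')
qed simp

lemma nat_int_diff: "nat (int a - int b) = a - b"
  by simp

lemma string_length_eqI:
  assumes "\<And>k. op_power g k b \<noteq> None \<longleftrightarrow> k \<le> m"
  shows "string_length g b = enat m"
proof -
  have "string_length g b = (SUP k\<in>{..m}. enat k)"
    using assms by (simp add: string_length_def atMost_def)
  also have "\<dots> = enat m"
    by (rule antisym) (auto intro!: SUP_least SUP_upper2[where i=m])
  finally show ?thesis .
qed

context string_crystal
begin

lemma op_power_down_iff: "op_power down k a \<noteq> None \<longleftrightarrow> k \<le> phi a"
proof (induction k arbitrary: a)
  case (Suc k)
  show ?case
  proof (cases "down a")
    case None
    then show ?thesis using down_None_iff[of a] by (simp add: op_power_Suc')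
  next
    case (Some b)
    then show ?thesis using Suc[of b] phi_down[OF Some] by (simp add: op_power_Suc')
  qed
qed simp

lemma string_length_down: "string_length down a = enat (phi a)"
  by (rule string_length_eqI) (rule op_power_down_iff)

lemma phi_eps_op_power_down:
  "op_power down k a = Some b \<Longrightarrow> phi a = phi b + k \<and> eps b = eps a + k"
proof (induction k arbitrary: b)
  case (Suc k)
  then obtain c where "op_power down k a = Some c" "down c = Some b"
    by (auto simp: op_power_Suc bind_eq_Some_conv)
  with Suc.IH[of c] phi_down[of c b] eps_down[of c b] show ?case by simp
qed simp

lemma op_power_inverse: "op_power down k a = Some b \<longleftrightarrow> op_power up k b = Some a"
proof (induction k arbitrary: a b)
  case (Suc k)
  have "op_power down (Suc k) a = Some b \<longleftrightarrow> (\<exists>c. op_power down k a = Some c \<and> down c = Some b)"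
    by (simp add: op_power_Suc bind_eq_Some_conv)
  also have "\<dots> \<longleftrightarrow> (\<exists>c. up b = Some c \<and> op_power up k c = Some a)"
    by (simp add: Suc up_iff_down conj_commute)
  also have "\<dots> \<longleftrightarrow> op_power up (Suc k) b = Some a"
    by (simp add: op_power_Suc' bind_eq_Some_conv)
  finally show ?case .
qed auto

lemmas op_power_up_iff = string_crystal.op_power_down_iff[OF opposite]
lemmas string_length_up = string_crystal.string_length_down[OF opposite]
lemmas phi_eps_op_power_up = string_crystal.phi_eps_op_power_down[OF opposite]

lemma reflect_eq:
  "reflect up down a =
    (if eps a \<le> phi a then the (op_power down (phi a - eps a) a)
     else the (op_power up (eps a - phi a) a))"
  by (auto simp: reflect_def string_length_down string_length_up Let_def nat_int_diff)

lemma reflect_eq_down: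
  assumes "op_power down k a = Some b" and "phi a = eps a + k"
  shows "reflect up down a = b"
  using assms by (simp add: reflect_eq)

lemma reflect_eq_up:
  assumes "op_power up k a = Some b" and "eps a = phi a + k"
  shows "reflect up down a = b"
  using assms by (auto simp: reflect_eq)

lemma reflect_reflect: "reflect up down (reflect up down a) = a"
proof (cases "eps a \<le> phi a")
  case True
  then obtain k where k: "phi a = eps a + k" by (auto simp: le_iff_add)
  then obtain b where b: "op_power down k a = Some b"
    using op_power_down_iff[of k a] by auto
  have "op_power up k b = Some a" using b op_power_inverse by blast
  moreover have "eps b = phi b + k" using phi_eps_op_power_down[OF b] k by simp
  ultimately show ?thesis using reflect_eq_down[OF b k] reflect_eq_up by metis
next
  case False
  then obtain k where k: "eps a = phi a + k" by (auto simp: not_le less_iff_Suc_add)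
  then obtain b where b: "op_power up k a = Some b"
    using op_power_up_iff[of k a] by auto
  have "op_power down k b = Some a" using b op_power_inverse by blast
  moreover have "phi b = eps b + k" using phi_eps_op_power_up[OF b] k by simp
  ultimately show ?thesis using reflect_eq_up[OF b k] reflect_eq_down by metis
qed

end

lemma op_power_rel:
  assumes "\<And>x y. R x y \<Longrightarrow> rel_option R (g x) (h y)" and "R x y"
  shows "rel_option R (op_power g k x) (op_power h k y)"
proof (induction k)
  case (Suc k)
  then show ?case using assms(1)
    by (cases "op_power g k x"; cases "op_power h k y") (auto simp: op_power_Suc)
qed (simp add: assms)

text \<open>
  Relations that respect an operator are the common notion behind crystal isomorphisms, changes
  of alphabet and local moves on words; \<open>reflect_rel\<close> shows that they respect
  reflections.
\<close>
definition simulates :: "('a \<Rightarrow> 'b \<Rightarrow> bool) \<Rightarrow> ('a \<Rightarrow> 'a option) \<Rightarrow> ('b \<Rightarrow> 'b option) \<Rightarrow> bool"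
  where "simulates R g h \<longleftrightarrow> (\<forall>x y. R x y \<longrightarrow> rel_option R (g x) (h y))"

lemma string_length_rel:
  assumes "simulates R g h" "R x y"
  shows "string_length g x = string_length h y"
proof -
  have "op_power g k x \<noteq> None \<longleftrightarrow> op_power h k y \<noteq> None" for k
    using op_power_rel[of R g h x y k] assms by (auto simp: simulates_def elim!: option.rel_cases)
  then show ?thesis by (simp add: string_length_def)
qed

lemma (in string_crystal) reflect_rel:
  assumes sim: "simulates R up' up" "simulates R down' down" and "R x y"
  shows "R (reflect up' down' x) (reflect up down y)"
proof -
  have pow: "rel_option R (op_power up' k x) (op_power up k y)"
    "rel_option R (op_power down' k x) (op_power down k y)" for k
    using op_power_rel[of R up' up x y k] op_power_rel[of R down' down x y k] assms
    by (auto simp: simulates_def)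
  have len: "string_length up' x = enat (eps y)" "string_length down' x = enat (phi y)"
    using string_length_rel[OF sim(1) \<open>R x y\<close>] string_length_rel[OF sim(2) \<open>R x y\<close>]
    by (simp_all add: string_length_up string_length_down)
  show ?thesis
  proof (cases "eps y \<le> phi y")
    case True
    moreover have "op_power down (phi y - eps y) y \<noteq> None"
      using op_power_down_iff by simp
    ultimately show ?thesis using pow(2)[of "phi y - eps y"]
      by (auto simp: reflect_eq reflect_def[of up'] len Let_def nat_int_diff option_rel_Some2)
  next
    case False
    moreover have "op_power up (eps y - phi y) y \<noteq> None"
      using op_power_up_iff by simp
    ultimately show ?thesis using pow(1)[of "eps y - phi y"]
      by (auto simp: reflect_eq reflect_def[of up'] len Let_def nat_int_diff option_rel_Some2)
  qed
qed

section \<open>Words and the tensor product rule\<close>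

text \<open>
  Tensor products of letters. A lowering step available in the tail \<open>w\<close> can be cancelled by a
  raising step available in the head \<open>x\<close>, and the operators act where something is left
  uncancelled. Truncated subtraction on the natural numbers counts what is left.
\<close>
fun word_phi :: "('a \<Rightarrow> nat) \<Rightarrow> ('a \<Rightarrow> nat) \<Rightarrow> 'a list \<Rightarrow> nat" where
  "word_phi eps phi [] = 0"
| "word_phi eps phi (x # w) = phi x + (word_phi eps phi w - eps x)"

fun word_eps :: "('a \<Rightarrow> nat) \<Rightarrow> ('a \<Rightarrow> nat) \<Rightarrow> 'a list \<Rightarrow> nat" where
  "word_eps eps phi [] = 0"
| "word_eps eps phi (x # w) = word_eps eps phi w + (eps x - word_phi eps phi w)"

fun word_down :: "('a \<Rightarrow> 'a option) \<Rightarrow> ('a \<Rightarrow> nat) \<Rightarrow> ('a \<Rightarrow> nat) \<Rightarrow> 'a list \<Rightarrow> 'a list option" where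
  "word_down down eps phi [] = None"
| "word_down down eps phi (x # w) =
    (if eps x < word_phi eps phi w then map_option (Cons x) (word_down down eps phi w)
     else map_option (\<lambda>y. y # w) (down x))"

fun word_up :: "('a \<Rightarrow> 'a option) \<Rightarrow> ('a \<Rightarrow> nat) \<Rightarrow> ('a \<Rightarrow> nat) \<Rightarrow> 'a list \<Rightarrow> 'a list option" where
  "word_up up eps phi [] = None"
| "word_up up eps phi (x # w) =
    (if eps x \<le> word_phi eps phi w then map_option (Cons x) (word_up up eps phi w)
     else map_option (\<lambda>y. y # w) (up x))"

context string_crystal
begin

abbreviation "wphi \<equiv> word_phi eps phi"
abbreviation "weps \<equiv> word_eps eps phi"
abbreviation "wdown \<equiv> word_down down eps phi"
abbreviation "wup \<equiv> word_up up eps phi"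

lemma wdown_None_iff: "wdown w = None \<longleftrightarrow> wphi w = 0"
  by (induction w) (auto simp: down_None_iff)

lemma wup_None_iff: "wup w = None \<longleftrightarrow> weps w = 0"
  by (induction w) (auto simp: up_None_iff)

lemma wdown_step: "wdown w = Some v \<Longrightarrow> wphi w = Suc (wphi v) \<and> weps v = Suc (weps w)"
proof (induction w arbitrary: v)
  case (Cons x w)
  show ?case
  proof (cases "eps x < wphi w")
    case True
    with Cons.prems obtain v' where "v = x # v'" "wdown w = Some v'" by auto
    with Cons.IH[of v'] True show ?thesis by auto
  next
    case False
    with Cons.prems obtain y where "v = y # w" "down x = Some y" by auto
    with False phi_down[of x y] eps_down[of x y] show ?thesis by auto
  qed
qed simp

lemma wup_step: "wup w = Some v \<Longrightarrow> wphi v = Suc (wphi w) \<and> weps w = Suc (weps v)"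
proof (induction w arbitrary: v)
  case (Cons x w)
  show ?case
  proof (cases "eps x \<le> wphi w")
    case True
    with Cons.prems obtain v' where "v = x # v'" "wup w = Some v'" by auto
    with Cons.IH[of v'] True show ?thesis by auto
  next
    case False
    with Cons.prems obtain y where "v = y # w" "down y = Some x" by (auto simp: up_iff_down)
    with False phi_down[of y x] eps_down[of y x] show ?thesis by auto
  qed
qed simp

lemma wdown_imp_wup: "wdown w = Some v \<Longrightarrow> wup v = Some w"
proof (induction w arbitrary: v)
  case (Cons x w)
  show ?case
  proof (cases "eps x < wphi w")
    case True
    with Cons.prems obtain v' where "v = x # v'" "wdown w = Some v'" by auto
    with Cons.IH[of v'] True wdown_step[of w v'] show ?thesis by auto
  next
    case False
    with Cons.prems obtain y where "v = y # w" "down x = Some y" by auto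
    with False eps_down[of x y] show ?thesis by (auto simp: up_iff_down)
  qed
qed simp

lemma wup_imp_wdown: "wup w = Some v \<Longrightarrow> wdown v = Some w"
proof (induction w arbitrary: v)
  case (Cons x w)
  show ?case
  proof (cases "eps x \<le> wphi w")
    case True
    with Cons.prems obtain v' where "v = x # v'" "wup w = Some v'" by auto
    with Cons.IH[of v'] True wup_step[of w v'] show ?thesis by auto
  next
    case False
    with Cons.prems obtain y where "v = y # w" "down y = Some x" by (auto simp: up_iff_down)
    with False eps_down[of y x] show ?thesis by auto
  qed
qed simp

text \<open>
  Words over a string crystal form a string crystal again, so all facts on strings apply to words
  as well as to letters.
\<close>
lemma word_string_crystal: "string_crystal wup wdown weps wphi"
proof
  show "wup b = Some a \<longleftrightarrow> wdown a = Some b" for a b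
    using wup_imp_wdown wdown_imp_wup by blast
qed (simp_all add: wdown_None_iff wup_None_iff wdown_step)

abbreviation "wreflect \<equiv> reflect wup wdown"

lemma wphi_append: "wphi (u @ v) = wphi u + (wphi v - weps u)"
  and weps_append: "weps (u @ v) = weps v + (weps u - wphi v)"
  by (induction u) auto

lemma wdown_append:
  "wdown (u @ v) =
    (if weps u < wphi v then map_option ((@) u) (wdown v) else map_option (\<lambda>u'. u' @ v) (wdown u))"
proof (induction u)
  case (Cons x u)
  then show ?case
    by (auto simp: wphi_append option.map_comp comp_def)
next
  case Nil
  then show ?case using wdown_None_iff[of v] by (cases "wdown v") auto
qed

lemma wup_append:
  "wup (u @ v) =
    (if weps u \<le> wphi v then map_option ((@) u) (wup v) else map_option (\<lambda>u'. u' @ v) (wup u))"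
proof (induction u)
  case (Cons x u)
  then show ?case
    by (auto simp: wphi_append option.map_comp comp_def)
next
  case Nil
  then show ?case by (cases "wup v") auto
qed

end

section \<open>Changing the alphabet\<close>

text \<open>
  A map \<open>h\<close> of alphabets that respects the operators need not be injective. What \<open>h\<close>
  forgets is recorded by \<open>frame\<close>, which the operators must not change; a word is then
  controlled by its image under \<open>h\<close> and its unchanged frame.
\<close>
locale letter_map =
  source: string_crystal up down eps phi + target: string_crystal up' down' eps' phi'
  for up down :: "'a \<Rightarrow> 'a option" and eps phi
    and up' down' :: "'b \<Rightarrow> 'b option" and eps' phi' +
  fixes h :: "'a \<Rightarrow> 'b" and frame :: "'a \<Rightarrow> 'c"
  assumes eps_h: "eps' (h x) = eps x"
    and phi_h: "phi' (h x) = phi x"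
    and down_h: "down x = Some y \<Longrightarrow> down' (h x) = Some (h y)"
    and frame_down: "down x = Some y \<Longrightarrow> frame y = frame x"
begin

lemma wphi_map: "target.wphi (map h w) = source.wphi w"
  by (induction w) (simp_all add: eps_h phi_h)

lemma weps_map: "target.weps (map h w) = source.weps w"
  by (induction w) (simp_all add: eps_h wphi_map)

lemma wdown_map:
  "source.wdown u = Some v \<Longrightarrow> target.wdown (map h u) = Some (map h v) \<and> map frame v = map frame u"
proof (induction u arbitrary: v)
  case (Cons x u)
  then show ?case
    by (auto simp: eps_h wphi_map down_h frame_down split: if_splits)
qed simp

lemma wup_map:
  assumes "source.wup u = Some v"
  shows "target.wup (map h u) = Some (map h v) \<and> map frame v = map frame u"
  using wdown_map[OF source.wup_imp_wdown[OF assms]] target.wdown_imp_wup by simp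

text \<open>
  With \<open>w\<close> fixed, the relation ``\<open>v\<close> is the image of \<open>u\<close>, and \<open>u\<close>
  has the same frame as \<open>w\<close>'' respects both operators.
\<close>
lemma wreflect_map:
  "map h (source.wreflect w) = target.wreflect (map h w)"
  "map frame (source.wreflect w) = map frame w"
proof -
  define R where "R = (\<lambda>u v. v = map h u \<and> map frame u = map frame w)"
  have "simulates R source.wup target.wup"
    unfolding simulates_def
  proof (intro allI impI)
    fix u v assume uv: "R u v"
    show "rel_option R (source.wup u) (target.wup v)"
    proof (cases "source.wup u")
      case None
      then have "target.wup v = None"
        using uv source.wup_None_iff[of u] target.wup_None_iff[of v] by (simp add: R_def weps_map)
      with None show ?thesis by simp
    next
      case (Some u')
      with uv wup_map[OF Some] show ?thesis by (simp add: R_def)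
    qed
  qed
  moreover have "simulates R source.wdown target.wdown"
    unfolding simulates_def
  proof (intro allI impI)
    fix u v assume uv: "R u v"
    show "rel_option R (source.wdown u) (target.wdown v)"
    proof (cases "source.wdown u")
      case None
      then have "target.wdown v = None"
        using uv source.wdown_None_iff[of u] target.wdown_None_iff[of v] by (simp add: R_def wphi_map)
      with None show ?thesis by simp
    next
      case (Some u')
      with uv wdown_map[OF Some] show ?thesis by (simp add: R_def)
    qed
  qed
  moreover have "R w (map h w)" by (simp add: R_def)
  ultimately have "R (source.wreflect w) (target.wreflect (map h w))"
    by (rule string_crystal.reflect_rel[OF target.word_string_crystal])
  then show "map h (source.wreflect w) = target.wreflect (map h w)"
    "map frame (source.wreflect w) = map frame w"
    by (simp_all add: R_def)
qed

end

section \<open>Lascoux--Schuetzenberger involutions\<close>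

definition value_down :: "nat \<Rightarrow> nat \<Rightarrow> nat option"
  where "value_down i x = (if x = i then Some (Suc i) else None)"
definition value_up :: "nat \<Rightarrow> nat \<Rightarrow> nat option"
  where "value_up i x = (if x = Suc i then Some i else None)"
definition value_eps :: "nat \<Rightarrow> nat \<Rightarrow> nat"
  where "value_eps i x = of_bool (x = Suc i)"
definition value_phi :: "nat \<Rightarrow> nat \<Rightarrow> nat"
  where "value_phi i x = of_bool (x = i)"

lemmas value_ops_defs = value_down_def value_up_def value_eps_def value_phi_def

lemma value_string_crystal: "string_crystal (value_up i) (value_down i) (value_eps i) (value_phi i)"
  by unfold_locales (auto simp: value_ops_defs split: if_splits)

definition value_reflect :: "nat \<Rightarrow> nat list \<Rightarrow> nat list"
  where "value_reflect i =
    reflect (word_up (value_up i) (value_eps i) (value_phi i)) (word_down (value_down i) (value_eps i) (value_phi i))"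

lemma value_reflect_involution: "value_reflect i (value_reflect i w) = w"
  unfolding value_reflect_def
  by (rule string_crystal.reflect_reflect[OF string_crystal.word_string_crystal[OF value_string_crystal]])

lemma value_reflect_map:
  assumes "\<And>x. h x = i \<longleftrightarrow> x = i" "\<And>x. h x = Suc i \<longleftrightarrow> x = Suc i"
  shows "map h (value_reflect i w) = value_reflect i (map h w)"
proof -
  have *: "h i = i" "h (Suc i) = Suc i"
    using assms by blast+
  interpret letter_map "value_up i" "value_down i" "value_eps i" "value_phi i"
    "value_up i" "value_down i" "value_eps i" "value_phi i" h "\<lambda>_. ()"
    by (intro letter_map.intro value_string_crystal letter_map_axioms.intro)
      (auto simp: value_ops_defs assms * split: if_splits)
  show ?thesis
    unfolding value_reflect_def by (rule wreflect_map)
qed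

lemma value_reflect_frame:
  assumes "frame (Suc i) = frame i"
  shows "map frame (value_reflect i w) = map frame w"
proof -
  interpret letter_map "value_up i" "value_down i" "value_eps i" "value_phi i"
    "value_up i" "value_down i" "value_eps i" "value_phi i" id frame
    by (intro letter_map.intro value_string_crystal letter_map_axioms.intro)
      (auto simp: value_ops_defs assms split: if_splits)
  show ?thesis
    unfolding value_reflect_def by (rule wreflect_map)
qed

lemma map_eq_jointly_injective:
  assumes "map f xs = map f ys" "map g xs = map g ys"
    and "\<And>x y. f x = f y \<Longrightarrow> g x = g y \<Longrightarrow> h x = h y"
  shows "map h xs = map h ys"
proof (rule nth_equalityI)
  show len: "length (map h xs) = length (map h ys)"
    using map_eq_imp_length_eq[OF assms(1)] by simp
  fix k assume "k < length (map h xs)"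
  with len have k: "k < length xs" "k < length ys" by simp_all
  have "f (xs ! k) = f (ys ! k)" "g (xs ! k) = g (ys ! k)"
    using k assms(1,2) by (metis nth_map)+
  then show "map h xs ! k = map h ys ! k"
    using k assms(3)[of "xs ! k" "ys ! k"] by simp
qed

text \<open>
  Each involution depends only on the positions of its own two letters, which the other one keeps:
  the maps \<open>hi\<close> and \<open>hj\<close> below forget all but one pair of letters, and \<open>g\<close>
  merges the two pairs. Jointly these maps determine the word.
\<close>
lemma value_reflect_commute:
  assumes "Suc i < j"
  shows "value_reflect i (value_reflect j w) = value_reflect j (value_reflect i w)"
proof -
  define hi where "hi = (\<lambda>x. if x = i \<or> x = Suc i then x else j)"
  define hj where "hj = (\<lambda>x. if x = j \<or> x = Suc j then x else i)"
  define g where "g = (\<lambda>x. if x = i \<or> x = Suc i \<or> x = j \<or> x = Suc j then i else x)"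
  note defs = hi_def hj_def g_def
  have i: "map hi (value_reflect i u) = value_reflect i (map hi u)"
    "map hj (value_reflect i u) = map hj u" "map g (value_reflect i u) = map g u" for u
    using assms by (intro value_reflect_map value_reflect_frame; auto simp: defs)+
  have j: "map hj (value_reflect j u) = value_reflect j (map hj u)"
    "map hi (value_reflect j u) = map hi u" "map g (value_reflect j u) = map g u" for u
    using assms by (intro value_reflect_map value_reflect_frame; auto simp: defs)+
  let ?u = "value_reflect i (value_reflect j w)" and ?v = "value_reflect j (value_reflect i w)"
  have "map (\<lambda>x. (hi x, hj x)) ?u = map (\<lambda>x. (hi x, hj x)) ?v"
    by (rule map_eq_jointly_injective[where f=hi and g=hj]) (simp_all add: i j)
  moreover have "map g ?u = map g ?v"
    by (simp add: i j)
  ultimately have "map id ?u = map id ?v"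
    by (rule map_eq_jointly_injective) (use assms in \<open>auto simp: defs split: if_splits\<close>)
  then show ?thesis by simp
qed

section \<open>The braid relation on words in three letters\<close>

text \<open>
  The letters 1, 2, 3 are the vector representation of $\mathfrak{gl}_3$. The column
  \<open>Col12\<close> stands for the word 21, and likewise for the other columns; the columns form the
  exterior square. \<open>Blank\<close> stands for all letters on which neither operator acts.
\<close>
datatype root = R1 | R2
datatype letter = Blank | One | Two | Three | Col12 | Col13 | Col23

fun letter_down :: "root \<Rightarrow> letter \<Rightarrow> letter option" where
  "letter_down R1 One = Some Two"
| "letter_down R1 Col13 = Some Col23"
| "letter_down R2 Two = Some Three"
| "letter_down R2 Col12 = Some Col13"
| "letter_down _ _ = None"

fun letter_up :: "root \<Rightarrow> letter \<Rightarrow> letter option" where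
  "letter_up R1 Two = Some One"
| "letter_up R1 Col23 = Some Col13"
| "letter_up R2 Three = Some Two"
| "letter_up R2 Col13 = Some Col12"
| "letter_up _ _ = None"

definition "letter_eps r x = (of_bool (letter_up r x \<noteq> None) :: nat)"
definition "letter_phi r x = (of_bool (letter_down r x \<noteq> None) :: nat)"

lemma letter_string_crystal:
  "string_crystal (letter_up r) (letter_down r) (letter_eps r) (letter_phi r)"
proof
  show "letter_up r b = Some a \<longleftrightarrow> letter_down r a = Some b" for a b
    by (cases r; cases a; cases b; simp)
  show "letter_phi r a = Suc (letter_phi r b)" if "letter_down r a = Some b" for a b
    using that by (cases r; cases a; auto simp: letter_phi_def)
  show "letter_eps r b = Suc (letter_eps r a)" if "letter_down r a = Some b" for a b
    using that by (cases r; cases a; auto simp: letter_eps_def)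
qed (auto simp: letter_eps_def letter_phi_def)

interpretation letters: string_crystal "letter_up r" "letter_down r" "letter_eps r" "letter_phi r" for r
  by (rule letter_string_crystal)

abbreviation letter_reflect :: "root \<Rightarrow> letter list \<Rightarrow> letter list"
  where "letter_reflect r \<equiv> letters.wreflect r"

definition braid_at :: "letter list \<Rightarrow> bool"
  where "braid_at w \<longleftrightarrow>
    letter_reflect R1 (letter_reflect R2 (letter_reflect R1 w)) =
    letter_reflect R2 (letter_reflect R1 (letter_reflect R2 w))"

subsection \<open>Local moves\<close>

text \<open>
  A set of replacements that respects both pairs of operators and in which the replaced word can be
  recovered from its replacement. The last condition is what allows an equation to be
  pulled back.
\<close>
definition local_move :: "(letter list \<times> letter list) set \<Rightarrow> bool"
  where "local_move M \<longleftrightarrow>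
    (\<forall>(p, q) \<in> M.
      (\<forall>r. letters.weps r p = letters.weps r q \<and> letters.wphi r p = letters.wphi r q \<and>
        rel_option (\<lambda>p q. (p, q) \<in> M) (letters.wup r p) (letters.wup r q) \<and>
        rel_option (\<lambda>p q. (p, q) \<in> M) (letters.wdown r p) (letters.wdown r q)) \<and>
      (\<forall>(p', q') \<in> M. q' = q \<longrightarrow> p' = p))"

text \<open>
  Inside a longer word the tensor product rule sees a factor only through its string lengths, so
  the replacement of a factor at a fixed place respects the operators. The lengths of
  \<open>a\<close> and \<open>b\<close> fix the place, and with it the replaced word is determined by the
  result. Both sides of the braid relation are therefore related to the same word.
\<close>
lemma braid_at_local_move:
  assumes M: "local_move M" "(p, q) \<in> M" and "braid_at (a @ q @ b)"
  shows "braid_at (a @ p @ b)"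
proof -
  define R where "R = (\<lambda>u v. \<exists>a' b' p' q'. length a' = length a \<and> length b' = length b \<and> (p', q') \<in> M \<and>
    u = a' @ p' @ b' \<and> v = a' @ q' @ b')"
  have unique: "u = u'" if "R u v" "R u' v" for u u' v
  proof -
    have "p' = p''" if "(p', q') \<in> M" "(p'', q') \<in> M" for p' p'' q'
      using that M(1) unfolding local_move_def by fast
    with that show ?thesis by (auto simp: R_def)
  qed
  have M': "letters.weps r p' = letters.weps r q'" "letters.wphi r p' = letters.wphi r q'"
    "rel_option (\<lambda>p q. (p, q) \<in> M) (letters.wup r p') (letters.wup r q')"
    "rel_option (\<lambda>p q. (p, q) \<in> M) (letters.wdown r p') (letters.wdown r q')"
    if "(p', q') \<in> M" for p' q' r
    using that M(1) unfolding local_move_def by fast+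
  have len: "length v = length u" if "letters.wup r u = Some v \<or> letters.wdown r u = Some v" for u v r
    using that
  proof (induction u arbitrary: v)
    case (Cons x u)
    then show ?case by (fastforce split: if_splits)
  qed simp
  have sim_up: "simulates R (letters.wup r) (letters.wup r)" for r
    unfolding simulates_def
  proof (intro allI impI)
    fix u v assume "R u v"
    then obtain a' b' p' q' where *: "length a' = length a" "length b' = length b" "(p', q') \<in> M"
      "u = a' @ p' @ b'" "v = a' @ q' @ b'"
      by (auto simp: R_def)
    have "rel_option R (map_option (\<lambda>p. a' @ p @ b') (letters.wup r p')) (map_option (\<lambda>p. a' @ p @ b') (letters.wup r q'))"
      unfolding option.rel_map by (rule option.rel_mono_strong[OF M'(3)[OF *(3)]]) (use * in \<open>auto simp: R_def\<close>)
    moreover have "rel_option R (map_option (\<lambda>p. p @ p' @ b') (letters.wup r a')) (map_option (\<lambda>p. p @ q' @ b') (letters.wup r a'))"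
      unfolding option.rel_map by (rule option.rel_refl_strong) (use * len in \<open>fastforce simp: R_def\<close>)
    moreover have "rel_option R (map_option (\<lambda>p. a' @ p' @ p) (letters.wup r b')) (map_option (\<lambda>p. a' @ q' @ p) (letters.wup r b'))"
      unfolding option.rel_map by (rule option.rel_refl_strong) (use * len in \<open>fastforce simp: R_def\<close>)
    ultimately show "rel_option R (letters.wup r u) (letters.wup r v)"
      using M'(1,2)[OF *(3)] unfolding *(4,5)
      by (simp add: letters.wup_append letters.weps_append letters.wphi_append option.map_comp comp_def)
  qed
  have sim_down: "simulates R (letters.wdown r) (letters.wdown r)" for r
    unfolding simulates_def
  proof (intro allI impI)
    fix u v assume "R u v"
    then obtain a' b' p' q' where *: "length a' = length a" "length b' = length b" "(p', q') \<in> M"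
      "u = a' @ p' @ b'" "v = a' @ q' @ b'"
      by (auto simp: R_def)
    have "rel_option R (map_option (\<lambda>p. a' @ p @ b') (letters.wdown r p')) (map_option (\<lambda>p. a' @ p @ b') (letters.wdown r q'))"
      unfolding option.rel_map by (rule option.rel_mono_strong[OF M'(4)[OF *(3)]]) (use * in \<open>auto simp: R_def\<close>)
    moreover have "rel_option R (map_option (\<lambda>p. p @ p' @ b') (letters.wdown r a')) (map_option (\<lambda>p. p @ q' @ b') (letters.wdown r a'))"
      unfolding option.rel_map by (rule option.rel_refl_strong) (use * len in \<open>fastforce simp: R_def\<close>)
    moreover have "rel_option R (map_option (\<lambda>p. a' @ p' @ p) (letters.wdown r b')) (map_option (\<lambda>p. a' @ q' @ p) (letters.wdown r b'))"
      unfolding option.rel_map by (rule option.rel_refl_strong) (use * len in \<open>fastforce simp: R_def\<close>)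
    ultimately show "rel_option R (letters.wdown r u) (letters.wdown r v)"
      using M'(1,2)[OF *(3)] unfolding *(4,5)
      by (simp add: letters.wdown_append letters.weps_append letters.wphi_append option.map_comp comp_def)
  qed
  have step: "R (letter_reflect r u) (letter_reflect r v)" if "R u v" for r u v
    by (rule string_crystal.reflect_rel[OF letters.word_string_crystal sim_up sim_down that])
  have R: "R (a @ p @ b) (a @ q @ b)"
    using M(2) by (auto simp: R_def)
  show ?thesis
    unfolding braid_at_def
  proof (rule unique)
    show "R (letter_reflect R1 (letter_reflect R2 (letter_reflect R1 (a @ p @ b))))
      (letter_reflect R1 (letter_reflect R2 (letter_reflect R1 (a @ q @ b))))"
      by (intro step R)
    have "R (letter_reflect R2 (letter_reflect R1 (letter_reflect R2 (a @ p @ b))))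
      (letter_reflect R2 (letter_reflect R1 (letter_reflect R2 (a @ q @ b))))"
      by (intro step R)
    then show "R (letter_reflect R2 (letter_reflect R1 (letter_reflect R2 (a @ p @ b))))
      (letter_reflect R1 (letter_reflect R2 (letter_reflect R1 (a @ q @ b))))"
      using assms(3) unfolding braid_at_def by simp
  qed
qed

text \<open>
  The six sets reflect decompositions of tensor products for $\mathfrak{gl}_3$, where $V$ is the
  vector representation and $\Lambda^2 V$ is spanned by columns: $\Lambda^2 V$ inside
  $V \otimes V$; a twist of $V$ inside $\Lambda^2 V \otimes \Lambda^2 V$; the common
  eight-dimensional part of $V \otimes \Lambda^2 V$ and $\Lambda^2 V \otimes V$; the
  one-dimensional parts of these two products; and the trivial letter. They are kept apart because
  a union would relate several words to the empty word and so lose injectivity.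
\<close>
definition "moves =
  {{([Two, One], [Col12]), ([Three, One], [Col13]), ([Three, Two], [Col23])},
   {([Col13, Col12], [One]), ([Col23, Col12], [Two]), ([Col23, Col13], [Three])},
   {([One, Col12], [Col12, One]), ([Two, Col12], [Col12, Two]), ([One, Col13], [Col13, One]),
    ([Two, Col13], [Col12, Three]), ([Three, Col13], [Col13, Three]), ([One, Col23], [Col13, Two]),
    ([Two, Col23], [Col23, Two]), ([Three, Col23], [Col23, Three])},
   {([Three, Col12], [])},
   {([Col23, One], [])},
   {([Blank], [])}}"

lemma local_move_moves: "M \<in> moves \<Longrightarrow> local_move M"
proof -
  have all_root: "(\<forall>r. P r) \<longleftrightarrow> P R1 \<and> P R2" for P
    by (metis root.exhaust)
  assume "M \<in> moves"
  then show ?thesis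
    unfolding moves_def
    by (elim insertE emptyE; simp add: local_move_def all_root letter_eps_def letter_phi_def)
qed

subsection \<open>Normal forms\<close>

text \<open>
  Irreducible words are column reading words of semistandard tableaux, which have at most two rows
  because columns of height three are deleted by the moves.
\<close>
definition reducible :: "letter list \<Rightarrow> bool"
  where "reducible w \<longleftrightarrow> (\<exists>a p q b. (p, q) \<in> \<Union>moves \<and> w = a @ p @ b)"

definition normal_word :: "nat \<Rightarrow> nat \<Rightarrow> nat \<Rightarrow> nat \<Rightarrow> nat \<Rightarrow> nat \<Rightarrow> letter list"
  where "normal_word i j k a b c =
    replicate i Col12 @ replicate j Col13 @ replicate k Col23 @
    replicate a One @ replicate b Two @ replicate c Three"

text \<open>
  Every descent in the order \<open>Col12\<close>, \<open>Col13\<close>, \<open>Col23\<close>, \<open>One\<close>,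
  \<open>Two\<close>, \<open>Three\<close> is the left side of a move, and so is \<open>Blank\<close>, so an
  irreducible word is a sorted word in the other letters.
  The move that deletes \<open>Col23\<close> followed by \<open>One\<close> accounts for the
  side condition.
\<close>
lemma irreducible_normal:
  "\<not> reducible w \<Longrightarrow> \<exists>i j k a b c. w = normal_word i j k a b c \<and> (k = 0 \<or> a = 0)"
proof (induction w)
  case Nil
  have "[] = normal_word 0 0 0 0 0 0" by (simp add: normal_word_def)
  then show ?case by blast
next
  case (Cons x w)
  have "\<not> reducible w"
  proof
    assume "reducible w"
    then obtain a p q b where "(p, q) \<in> \<Union>moves" "w = a @ p @ b"
      unfolding reducible_def by blast
    then have "(p, q) \<in> \<Union>moves \<and> x # w = (x # a) @ p @ b" by simp
    with Cons.prems show False unfolding reducible_def by blast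
  qed
  with Cons.IH obtain i j k a b c where w: "w = normal_word i j k a b c" and ka: "k = 0 \<or> a = 0"
    by blast
  have single: "([x], q) \<notin> \<Union>moves" for q
  proof
    assume "([x], q) \<in> \<Union>moves"
    moreover have "x # w = [] @ [x] @ w" by simp
    ultimately show False using Cons.prems unfolding reducible_def by blast
  qed
  have pair: "([x, y], q) \<notin> \<Union>moves" if "w = y # v" for y v q
  proof
    assume "([x, y], q) \<in> \<Union>moves"
    moreover have "x # w = [] @ [x, y] @ v" using that by simp
    ultimately show False using Cons.prems unfolding reducible_def by blast
  qed
  have i: "i = 0 \<or> x = Col12"
  proof (cases i)
    case (Suc i')
    then have "w = Col12 # normal_word i' j k a b c" by (simp add: w normal_word_def)
    from pair[OF this] single show ?thesis by (cases x) (auto simp: moves_def)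
  qed simp
  have j: "j = 0 \<or> x = Col12 \<or> x = Col13" if "i = 0"
  proof (cases j)
    case (Suc j')
    with that have "w = Col13 # normal_word 0 j' k a b c" by (simp add: w normal_word_def)
    from pair[OF this] single show ?thesis by (cases x) (auto simp: moves_def)
  qed simp
  have k: "k = 0 \<or> x = Col12 \<or> x = Col13 \<or> x = Col23" if "i = 0" "j = 0"
  proof (cases k)
    case (Suc k')
    with that have "w = Col23 # normal_word 0 0 k' a b c" by (simp add: w normal_word_def)
    from pair[OF this] single show ?thesis by (cases x) (auto simp: moves_def)
  qed simp
  have a: "a = 0 \<or> x = Col12 \<or> x = Col13 \<or> x = One" if "i = 0" "j = 0" "k = 0"
  proof (cases a)
    case (Suc a')
    with that have "w = One # normal_word 0 0 0 a' b c" by (simp add: w normal_word_def)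
    from pair[OF this] single show ?thesis by (cases x) (auto simp: moves_def)
  qed simp
  have b: "b = 0 \<or> x \<noteq> Three" if "i = 0" "j = 0" "k = 0" "a = 0"
  proof (cases b)
    case (Suc b')
    with that have "w = Two # normal_word 0 0 0 0 b' c" by (simp add: w normal_word_def)
    from pair[OF this] single show ?thesis by (cases x) (auto simp: moves_def)
  qed simp
  show ?case
  proof (cases x)
    case Blank
    then show ?thesis using single[of "[]"] by (simp add: moves_def)
  next
    case Col12
    then have "x # w = normal_word (Suc i) j k a b c" by (simp add: w normal_word_def)
    with ka show ?thesis by blast
  next
    case Col13
    with i have "x # w = normal_word 0 (Suc j) k a b c" by (auto simp: w normal_word_def)
    with ka show ?thesis by blast
  next
    case Col23
    with i j have 0: "i = 0" "j = 0" by auto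
    with Col23 have "x # w = normal_word 0 0 (Suc k) a b c" by (simp add: w normal_word_def)
    moreover have "a = 0" using a[OF 0] ka Col23 by auto
    ultimately show ?thesis by blast
  next
    case One
    with i j k have "x # w = normal_word 0 0 0 (Suc a) b c" by (auto simp: w normal_word_def)
    then show ?thesis by blast
  next
    case Two
    with i j k a have "x # w = normal_word 0 0 0 0 (Suc b) c" by (auto simp: w normal_word_def)
    then show ?thesis by blast
  next
    case Three
    with i j k a b have "x # w = normal_word 0 0 0 0 0 (Suc c)" by (auto simp: w normal_word_def)
    then show ?thesis by blast
  qed
qed

definition entries :: "letter list \<Rightarrow> nat"
  where "entries w = length (filter (\<lambda>x. x \<in> {One, Two, Three}) w)"

definition columns :: "letter list \<Rightarrow> nat"
  where "columns w = length (filter (\<lambda>x. x \<in> {Col12, Col13, Col23}) w)"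

text \<open>
  The number of pairs of a letter 1, 2 or 3 and a later column. It decreases under the moves that
  keep the length.
\<close>
fun disorder :: "letter list \<Rightarrow> nat" where
  "disorder [] = 0"
| "disorder (x # w) = entries [x] * columns w + disorder w"

lemma disorder_append: "disorder (u @ v) = disorder u + disorder v + entries u * columns v"
  by (induction u) (auto simp: entries_def columns_def algebra_simps)

lemma moves_decrease:
  assumes "(p, q) \<in> \<Union>moves"
  shows "length q < length p \<or> length q = length p \<and>
    disorder q < disorder p \<and> entries q = entries p \<and> columns q = columns p"
  using assms unfolding moves_def by (auto simp: entries_def columns_def)

subsection \<open>Reflections of normal forms\<close>

context string_crystal
begin

lemma inert_replicate:
  assumes "phi x = 0" "eps x = 0"
  shows "wphi (replicate m x) = 0" "weps (replicate m x) = 0"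
  using assms by (induction m) auto

definition edge :: "'a \<Rightarrow> 'a \<Rightarrow> bool"
  where "edge p q \<longleftrightarrow> down p = Some q \<and> phi p = 1 \<and> eps p = 0 \<and> phi q = 0 \<and> eps q = 1"

definition block :: "'a \<Rightarrow> 'a \<Rightarrow> nat \<Rightarrow> nat \<Rightarrow> 'a list"
  where "block p q j k = replicate j p @ replicate k q"

lemma block_phi_eps:
  assumes "edge p q"
  shows "wphi (block p q j k) = j" "weps (block p q j k) = k"
proof -
  have "wphi (replicate j p) = j" "weps (replicate j p) = 0" for j
    using assms by (induction j) (auto simp: edge_def)
  moreover have "wphi (replicate k q) = 0" "weps (replicate k q) = k" for k
    using assms by (induction k) (auto simp: edge_def)
  ultimately show "wphi (block p q j k) = j" "weps (block p q j k) = k"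
    by (simp_all add: block_def wphi_append weps_append)
qed

lemma block_down:
  assumes "edge p q"
  shows "wdown (block p q (Suc j) k) = Some (block p q j (Suc k))"
proof -
  have p: "wphi (replicate j p) = j" for j
    using block_phi_eps(1)[OF assms, of j 0] by (simp add: block_def)
  have "wdown (replicate (Suc j) p) = Some (replicate j p @ [q])"
    using assms
  proof (induction j)
    case (Suc j)
    have "eps p < wphi (replicate (Suc j) p)"
      using p[of "Suc j"] assms by (simp add: edge_def del: replicate_Suc)
    then have "wdown (p # replicate (Suc j) p) = Some (p # replicate j p @ [q])"
      using Suc by (simp del: replicate_Suc)
    then show ?case by (metis replicate_Suc append_Cons)
  qed (auto simp: edge_def)
  moreover have "wphi (replicate k q) = 0"
    using block_phi_eps(1)[OF assms, of 0 k] by (simp add: block_def)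
  ultimately show ?thesis
    by (simp add: block_def wdown_append del: replicate_Suc)
      (simp add: replicate_app_Cons_same)
qed

text \<open>
  With respect to either root, a normal form consists of two blocks of the shape
  $p \dots p\, q \dots q$ with $p \to q$, separated by inert words.
\<close>
definition two_blocks ::
  "'a \<Rightarrow> 'a \<Rightarrow> 'a \<Rightarrow> 'a \<Rightarrow> 'a list \<Rightarrow> 'a list \<Rightarrow> 'a list \<Rightarrow> nat \<Rightarrow> nat \<Rightarrow> nat \<Rightarrow> nat \<Rightarrow> 'a list"
  where "two_blocks p q p' q' z0 z1 z2 j k a b = z0 @ block p q j k @ z1 @ block p' q' a b @ z2"

context
  fixes p q p' q' z0 z1 z2
  assumes edges: "edge p q" "edge p' q'"
    and inert: "wphi z0 = 0" "weps z0 = 0" "wphi z1 = 0" "weps z1 = 0" "wphi z2 = 0" "weps z2 = 0"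
begin

private abbreviation "W \<equiv> two_blocks p q p' q' z0 z1 z2"

lemma inert_down: "wdown z0 = None" "wdown z1 = None" "wdown z2 = None"
  by (simp_all add: wdown_None_iff inert)

lemma two_blocks_phi_eps:
  "wphi (W j k a b) = j + (a - k)" "weps (W j k a b) = b + (k - a)"
  by (simp_all add: two_blocks_def wphi_append weps_append inert block_phi_eps edges)

lemma two_blocks_down_right:
  "k \<le> a \<Longrightarrow> wdown (W j k (Suc a) b) = Some (W j k a (Suc b))"
  by (simp add: two_blocks_def wdown_append wphi_append weps_append inert block_phi_eps
      block_down edges inert_down)

lemma two_blocks_down_left:
  "a \<le> k \<Longrightarrow> wdown (W (Suc j) k a b) = Some (W j (Suc k) a b)"
  by (simp add: two_blocks_def wdown_append wphi_append weps_append inert block_phi_eps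
      block_down edges inert_down)

lemma down_right_power:
  "k \<le> a \<Longrightarrow> op_power wdown d (W j k (a + d) b) = Some (W j k a (b + d))"
proof (induction d arbitrary: b)
  case (Suc d)
  then show ?case using Suc.IH[of "Suc b"] two_blocks_down_right[of k "a + d" j b]
    by (simp add: op_power_Suc')
qed simp

lemma down_left_power:
  "a \<le> k \<Longrightarrow> op_power wdown d (W (j + d) k a b) = Some (W j (k + d) a b)"
proof (induction d arbitrary: k)
  case (Suc d)
  then show ?case using Suc.IH[of "Suc k"] two_blocks_down_left[of a k "j + d" b]
    by (simp add: op_power_Suc')
qed simp

text \<open>
  Here \<open>n\<close> is the number of cancelled pairs between the blocks, and \<open>m\<close> the common
  part of the outer multiplicities. In these coordinates the reflection simply swaps \<open>j\<close>
  with \<open>k\<close> and \<open>a\<close> with \<open>b\<close>. When lowering is needed, it first acts on the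
  right block, as long as that has uncancelled letters, and then on the left block.
\<close>
lemma reflect_two_blocks_down:
  assumes "k = 0 \<or> a = 0" "j = 0 \<or> b = 0" and le: "b + k \<le> j + a"
  shows "wreflect (W (m + j) (n + k) (n + a) (m + b)) =
    W (m + k) (n + j) (n + b) (m + a)"
proof -
  obtain d where d: "j + a = b + k + d"
    using le le_Suc_ex by blast
  have "op_power wdown d (W (m + j) (n + k) (n + a) (m + b)) =
    Some (W (m + k) (n + j) (n + b) (m + a))"
  proof (cases "k = 0")
    case k: True
    show ?thesis
    proof (cases "b = 0")
      case True
      have "op_power wdown a (W (m + j) n (n + a) m) = Some (W (m + j) n n (m + a))"
        by (rule down_right_power) simp
      moreover have "op_power wdown j (W (m + j) n n (m + a)) = Some (W m (n + j) n (m + a))"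
        by (rule down_left_power) simp
      moreover have "d = a + j" using d k True by simp
      ultimately show ?thesis using k True by (simp add: op_power_add)
    next
      case False
      then show ?thesis
        using assms(2) d k down_right_power[of n "n + b" d m "m + b"] by (simp add: add.assoc)
    qed
  next
    case False
    then have "a = 0" using assms(1) by simp
    then have "b = 0" "j = k + d" using False assms(2) d by auto
    then show ?thesis
      using \<open>a = 0\<close> down_left_power[of n "n + k" d "m + k" m] by (simp add: add.assoc)
  qed
  then show ?thesis
    by (rule string_crystal.reflect_eq_down[OF word_string_crystal])
      (use assms(1,2) d in \<open>auto simp: two_blocks_phi_eps\<close>)
qed

text \<open>
  The case in which raising is needed follows from the other one, since reflections are
  involutions and the formula is symmetric.
\<close>
lemma reflect_two_blocks:
  assumes "k = 0 \<or> a = 0" "j = 0 \<or> b = 0"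
  shows "wreflect (W (m + j) (n + k) (n + a) (m + b)) =
    W (m + k) (n + j) (n + b) (m + a)"
proof (cases "b + k \<le> j + a")
  case True
  then show ?thesis using assms reflect_two_blocks_down by simp
next
  case False
  then have "wreflect (W (m + k) (n + j) (n + b) (m + a)) =
    W (m + j) (n + k) (n + a) (m + b)"
    using assms by (intro reflect_two_blocks_down) auto
  then show ?thesis
    using string_crystal.reflect_reflect[OF word_string_crystal] by metis
qed

end

end

lemma reflect_R1_normal:
  assumes "k = 0 \<or> a = 0" "j = 0 \<or> b = 0"
  shows "letter_reflect R1 (normal_word i (m + j) (n + k) (n + a) (m + b) c) =
    normal_word i (m + k) (n + j) (n + b) (m + a) c"
proof -
  have "letters.edge R1 Col13 Col23" "letters.edge R1 One Two"
    by (simp_all add: letters.edge_def letter_eps_def letter_phi_def)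
  from letters.reflect_two_blocks[OF this, of "replicate i Col12" "[]" "replicate c Three", OF _ _ _ _ _ _ assms]
  show ?thesis
    by (simp add: letters.two_blocks_def letters.block_def normal_word_def
        letters.inert_replicate letter_eps_def letter_phi_def)
qed

lemma reflect_R2_normal:
  assumes "j = 0 \<or> b = 0" "i = 0 \<or> c = 0"
  shows "letter_reflect R2 (normal_word (m + i) (n + j) k a (n + b) (m + c)) =
    normal_word (m + j) (n + i) k a (n + c) (m + b)"
proof -
  have edges: "letters.edge R2 Col12 Col13" "letters.edge R2 Two Three"
    by (simp_all add: letters.edge_def letter_eps_def letter_phi_def)
  have "letters.wphi R2 (replicate k Col23 @ replicate a One) = 0"
    "letters.weps R2 (replicate k Col23 @ replicate a One) = 0"
    by (simp_all add: letters.wphi_append letters.weps_append letters.inert_replicate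
        letter_eps_def letter_phi_def)
  then show ?thesis
    using letters.reflect_two_blocks[OF edges, of "[]" "replicate k Col23 @ replicate a One" "[]", OF _ _ _ _ _ _ assms]
    by (simp add: letters.two_blocks_def letters.block_def normal_word_def)
qed

lemma common_part:
  fixes x y :: nat
  obtains n x' y' where "x = n + x'" "y = n + y'" "x' = 0 \<or> y' = 0"
  using that[of x 0 "y - x"] that[of y "x - y" 0] by fastforce

text \<open>
  In the coordinates of \<open>reflect_two_blocks\<close> both sides of the braid relation are chains of
  three swaps, and each intermediate word is again visibly of the required form.
\<close>
lemma braid_at_normal:
  assumes "k = 0 \<or> a = 0"
  shows "braid_at (normal_word i j k a b c)"
proof -
  obtain n j' b' where jb: "j = n + j'" "b = n + b'" "j' = 0 \<or> b' = 0"
    by (rule common_part)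
  obtain m i' c' where ic: "i = m + i'" "c = m + c'" "i' = 0 \<or> c' = 0"
    by (rule common_part)
  have "letter_reflect R1 (normal_word i j k a b c) = normal_word i (n + k) j' b' (n + a) c"
    using reflect_R1_normal[of k a j' b' i n 0 c] assms jb by simp
  moreover have "letter_reflect R2 \<dots> = normal_word (m + k) (n + i') j' b' (n + c') (m + a)"
    using reflect_R2_normal[of k a i' c' m n j' b'] assms ic by simp
  moreover have "letter_reflect R1 \<dots> = normal_word (m + k) (n + j') i' c' (n + b') (m + a)"
    using reflect_R1_normal[of j' b' i' c' "m + k" n 0 "m + a"] jb ic by simp
  moreover have "letter_reflect R2 (normal_word i j k a b c) = normal_word (m + j') (n + i') k a (n + c') (m + b')"
    using reflect_R2_normal[of j' b' i' c' m n k a] jb ic by simp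
  moreover have "letter_reflect R1 \<dots> = normal_word (m + j') (n + k) i' c' (n + a) (m + b')"
    using reflect_R1_normal[of k a i' c' "m + j'" n 0 "m + b'"] assms ic by simp
  moreover have "letter_reflect R2 \<dots> = normal_word (m + k) (n + j') i' c' (n + b') (m + a)"
    using reflect_R2_normal[of k a j' b' m n i' c'] assms jb by simp
  ultimately show ?thesis by (simp add: braid_at_def)
qed

text \<open>
  Induction along the moves, which decrease first the length and then the disorder.
\<close>
theorem braid_at_letters: "braid_at w"
proof (induction w rule: wf_induct[OF wf_measures[of "[length, disorder]"]])
  case (1 w)
  show ?case
  proof (cases "reducible w")
    case True
    then obtain a p q b M where M: "M \<in> moves" "(p, q) \<in> M" and w: "w = a @ p @ b"
      unfolding reducible_def by blast
    have "(a @ q @ b, w) \<in> measures [length, disorder]"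
    proof -
      have "length q < length p \<or> length q = length p \<and>
          disorder q < disorder p \<and> entries q = entries p \<and> columns q = columns p"
        using M by (intro moves_decrease) blast
      moreover have "columns (u @ v) = columns u + columns v" for u v
        by (simp add: columns_def)
      ultimately show ?thesis
        by (auto simp: w disorder_append)
    qed
    with 1 have "braid_at (a @ q @ b)" by blast
    then show ?thesis
      unfolding w by (rule braid_at_local_move[OF local_move_moves[OF M(1)] M(2)])
  next
    case False
    then show ?thesis using irreducible_normal braid_at_normal by blast
  qed
qed

text \<open>
  Applied to a word of integers, this isolates the three letters that the involutions with indices
  \<open>i\<close> and \<open>i + 1\<close> can change.
\<close>
definition collapse :: "nat \<Rightarrow> nat \<Rightarrow> letter"
  where "collapse i x = (if x = i then One else if x = Suc i then Two
    else if x = Suc (Suc i) then Three else Blank)"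

lemma value_reflect_collapse:
  "map (collapse i) (value_reflect i w) = letter_reflect R1 (map (collapse i) w)"
  "map (collapse i) (value_reflect (Suc i) w) = letter_reflect R2 (map (collapse i) w)"
proof -
  interpret m1: letter_map "value_up i" "value_down i" "value_eps i" "value_phi i"
    "letter_up R1" "letter_down R1" "letter_eps R1" "letter_phi R1" "collapse i" "\<lambda>_. ()"
    by (intro letter_map.intro value_string_crystal letter_string_crystal letter_map_axioms.intro)
      (auto simp: value_ops_defs collapse_def letter_eps_def letter_phi_def split: if_splits)
  interpret m2: letter_map "value_up (Suc i)" "value_down (Suc i)" "value_eps (Suc i)" "value_phi (Suc i)"
    "letter_up R2" "letter_down R2" "letter_eps R2" "letter_phi R2" "collapse i" "\<lambda>_. ()"
    by (intro letter_map.intro value_string_crystal letter_string_crystal letter_map_axioms.intro)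
      (auto simp: value_ops_defs collapse_def letter_eps_def letter_phi_def split: if_splits)
  show "map (collapse i) (value_reflect i w) = letter_reflect R1 (map (collapse i) w)"
    "map (collapse i) (value_reflect (Suc i) w) = letter_reflect R2 (map (collapse i) w)"
    unfolding value_reflect_def by (rule m1.wreflect_map m2.wreflect_map)+
qed

lemma value_reflect_braid:
  "value_reflect i (value_reflect (Suc i) (value_reflect i w)) =
    value_reflect (Suc i) (value_reflect i (value_reflect (Suc i) w))" (is "?u = ?v")
proof -
  define rest where "rest x = (if x \<in> {i, Suc i, Suc (Suc i)} then i else x)" for x
  have "map (collapse i) ?u = map (collapse i) ?v"
    using braid_at_letters[of "map (collapse i) w"]
    by (simp add: value_reflect_collapse braid_at_def)
  moreover have "map rest (value_reflect i u) = map rest u"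
    "map rest (value_reflect (Suc i) u) = map rest u" for u
    by (simp_all add: value_reflect_frame rest_def)
  then have "map rest ?u = map rest ?v" by simp
  ultimately have "map id ?u = map id ?v"
    by (rule map_eq_jointly_injective) (auto simp: collapse_def rest_def split: if_splits)
  then show ?thesis by simp
qed

section \<open>Words of boxes\<close>

fun box_value :: "box \<Rightarrow> nat" where
  "box_value (Box j) = j"
| "box_value (Box' j) = j"

fun box_primed :: "box \<Rightarrow> bool" where
  "box_primed (Box j) \<longleftrightarrow> False"
| "box_primed (Box' j) \<longleftrightarrow> True"

abbreviation "box_eps i x \<equiv> value_eps i (box_value x)"
abbreviation "box_phi i x \<equiv> value_phi i (box_value x)"

lemma box_string_crystal:
  assumes "0 < i"
  shows "string_crystal (box_raise (Op i)) (box_lower (Op i)) (box_eps i) (box_phi i)"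
proof
  show "box_raise (Op i) b = Some a \<longleftrightarrow> box_lower (Op i) a = Some b" for a b
    using assms by (cases a; cases b) auto
  show "box_lower (Op i) a = None \<longleftrightarrow> box_phi i a = 0" for a
    using assms by (cases a) (auto simp: value_phi_def)
  show "box_raise (Op i) a = None \<longleftrightarrow> box_eps i a = 0" for a
    using assms by (cases a) (auto simp: value_eps_def)
  show "box_phi i a = Suc (box_phi i b)" "box_eps i b = Suc (box_eps i a)"
    if "box_lower (Op i) a = Some b" for a b
    using assms that by (cases a; auto simp: value_phi_def value_eps_def split: if_splits)+
qed

text \<open>
  The operators with index 0 do not follow the rule for the other indices: they act on the first
  box of value 1.
\<close>
fun zero_raise :: "box list \<Rightarrow> box list option" where
  "zero_raise [] = None"
| "zero_raise (x # w) =
    (if box_value x = 1 then (if box_primed x then Some (Box 1 # w) else None)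
     else map_option (Cons x) (zero_raise w))"

fun zero_lower :: "box list \<Rightarrow> box list option" where
  "zero_lower [] = None"
| "zero_lower (x # w) =
    (if box_value x = 1 then (if box_primed x then None else Some (Box' 1 # w))
     else map_option (Cons x) (zero_lower w))"

fun zero_eps :: "box list \<Rightarrow> nat" where
  "zero_eps [] = 0"
| "zero_eps (x # w) = (if box_value x = 1 then of_bool (box_primed x) else zero_eps w)"

fun zero_phi :: "box list \<Rightarrow> nat" where
  "zero_phi [] = 0"
| "zero_phi (x # w) = (if box_value x = 1 then of_bool (\<not> box_primed x) else zero_phi w)"

lemma zero_string_crystal: "string_crystal zero_raise zero_lower zero_eps zero_phi"
proof
  have box: "x = (if box_primed x then Box' (box_value x) else Box (box_value x))" for x
    by (cases x) auto
  have "zero_lower a = Some b \<Longrightarrow>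
    zero_raise b = Some a \<and> zero_phi a = Suc (zero_phi b) \<and> zero_eps b = Suc (zero_eps a)" for a b
  proof (induction a arbitrary: b)
    case (Cons x a)
    then show ?case using box[of x] by (auto split: if_splits)
  qed simp
  moreover have "zero_raise b = Some a \<Longrightarrow> zero_lower a = Some b" for a b
  proof (induction b arbitrary: a)
    case (Cons x b)
    then show ?case using box[of x] by (auto split: if_splits)
  qed simp
  ultimately show "zero_raise b = Some a \<longleftrightarrow> zero_lower a = Some b"
    and "zero_lower a = Some b \<Longrightarrow> zero_phi a = Suc (zero_phi b)"
    and "zero_lower a = Some b \<Longrightarrow> zero_eps b = Suc (zero_eps a)" for a b
    by blast+
  show "zero_lower a = None \<longleftrightarrow> zero_phi a = 0" for a
    by (induction a) auto
  show "zero_raise a = None \<longleftrightarrow> zero_eps a = 0" for a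
    by (induction a) auto
qed

definition box_word_raise :: "nat \<Rightarrow> box list \<Rightarrow> box list option"
  where "box_word_raise i =
    (if i = 0 then zero_raise else word_up (box_raise (Op i)) (box_eps i) (box_phi i))"

definition box_word_lower :: "nat \<Rightarrow> box list \<Rightarrow> box list option"
  where "box_word_lower i =
    (if i = 0 then zero_lower else word_down (box_lower (Op i)) (box_eps i) (box_phi i))"

definition box_word_eps :: "nat \<Rightarrow> box list \<Rightarrow> nat"
  where "box_word_eps i = (if i = 0 then zero_eps else word_eps (box_eps i) (box_phi i))"

definition box_word_phi :: "nat \<Rightarrow> box list \<Rightarrow> nat"
  where "box_word_phi i = (if i = 0 then zero_phi else word_phi (box_eps i) (box_phi i))"

lemma box_word_string_crystal:
  "string_crystal (box_word_raise i) (box_word_lower i) (box_word_eps i) (box_word_phi i)"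
  using zero_string_crystal string_crystal.word_string_crystal[OF box_string_crystal[of i]]
  by (cases "i = 0") (simp_all add: box_word_raise_def box_word_lower_def box_word_eps_def box_word_phi_def)

interpretation box_words: string_crystal "box_word_raise i" "box_word_lower i" "box_word_eps i" "box_word_phi i" for i
  by (rule box_word_string_crystal)

abbreviation box_reflect :: "nat \<Rightarrow> box list \<Rightarrow> box list"
  where "box_reflect i \<equiv> reflect (box_word_raise i) (box_word_lower i)"

fun toggle_first_one :: "nat list \<Rightarrow> bool list \<Rightarrow> bool list" where
  "toggle_first_one (x # U) (p # P) = (if x = 1 then (\<not> p) # P else p # toggle_first_one U P)"
| "toggle_first_one [] P = P"
| "toggle_first_one U [] = []"

text \<open>
  This is the source of the relation of length four: both sides toggle the primes at two places
  that depend on values only.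
\<close>
lemma toggle_commute:
  "toggle_first_one U (toggle_first_one V P) = toggle_first_one V (toggle_first_one U P)"
proof (induction P arbitrary: U V)
  case Nil
  show ?case by (cases U; cases V) auto
next
  case (Cons p P)
  then show ?case by (cases U; cases V) auto
qed

lemma toggle_cong:
  "map (\<lambda>x. x = 1) U = map (\<lambda>x. x = 1) V \<Longrightarrow> toggle_first_one U P = toggle_first_one V P"
proof (induction P arbitrary: U V)
  case Nil
  show ?case by (cases U; cases V) auto
next
  case (Cons p P)
  show ?case using Cons.prems by (cases U; cases V) (auto intro: Cons.IH)
qed

lemma box_reflect_pos:
  assumes "0 < i"
  shows "map box_value (box_reflect i w) = value_reflect i (map box_value w)"
    and "map box_primed (box_reflect i w) = map box_primed w"
proof -
  interpret letter_map "box_raise (Op i)" "box_lower (Op i)" "box_eps i" "box_phi i"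
    "value_up i" "value_down i" "value_eps i" "value_phi i" box_value box_primed
  proof (intro letter_map.intro box_string_crystal value_string_crystal letter_map_axioms.intro assms)
    show "value_down i (box_value x) = Some (box_value y)" "box_primed y = box_primed x"
      if "box_lower (Op i) x = Some y" for x y
      using that assms by (cases x; auto simp: value_down_def split: if_splits)+
  qed simp_all
  show "map box_value (box_reflect i w) = value_reflect i (map box_value w)"
    "map box_primed (box_reflect i w) = map box_primed w"
    using assms wreflect_map[of w] by (simp_all add: box_word_raise_def box_word_lower_def value_reflect_def)
qed

text \<open>
  At most one of the operators with index 0 applies, and it changes the prime of the first box of
  value 1; reflection is thus the toggle.
\<close>
lemma box_reflect_0:
  "map box_value (box_reflect 0 w) = map box_value w"
  "map box_primed (box_reflect 0 w) = toggle_first_one (map box_value w) (map box_primed w)"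
proof -
  have lower: "map box_value v = map box_value u \<and>
      map box_primed v = toggle_first_one (map box_value u) (map box_primed u)"
    if "zero_lower u = Some v" for u v
    using that by (induction u arbitrary: v) (auto split: if_splits)
  have raise: "map box_value v = map box_value u \<and>
      map box_primed v = toggle_first_one (map box_value u) (map box_primed u)"
    if "zero_raise u = Some v" for u v
    using that by (induction u arbitrary: v) (auto split: if_splits)
  have neither: "toggle_first_one (map box_value u) (map box_primed u) = map box_primed u"
    if "zero_eps u = 0" "zero_phi u = 0" for u
    using that by (induction u) (auto split: if_splits)
  have "zero_eps w = 0 \<and> zero_phi w = 0 \<or> zero_eps w = 1 \<and> zero_phi w = 0 \<or> zero_eps w = 0 \<and> zero_phi w = 1"
    by (induction w) auto
  then consider "zero_eps w = 0" "zero_phi w = 0" | "zero_eps w = 1" "zero_phi w = 0"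
    | "zero_eps w = 0" "zero_phi w = 1" by argo
  then have "map box_value (box_reflect 0 w) = map box_value w \<and>
    map box_primed (box_reflect 0 w) = toggle_first_one (map box_value w) (map box_primed w)"
  proof cases
    case 1
    then have "box_reflect 0 w = w"
      by (intro box_words.reflect_eq_down[where k = 0]) (simp_all add: box_word_eps_def box_word_phi_def)
    with neither 1 show ?thesis by simp
  next
    case 2
    then obtain v where v: "zero_raise w = Some v"
      using string_crystal.up_None_iff[OF zero_string_crystal, of w] by auto
    then have "box_reflect 0 w = v"
      using 2 by (intro box_words.reflect_eq_up[where k = 1])
        (simp_all add: box_word_eps_def box_word_phi_def box_word_raise_def op_power_Suc)
    with raise[OF v] show ?thesis by simp
  next
    case 3
    then obtain v where v: "zero_lower w = Some v"
      using string_crystal.down_None_iff[OF zero_string_crystal, of w] by auto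
    then have "box_reflect 0 w = v"
      using 3 by (intro box_words.reflect_eq_down[where k = 1])
        (simp_all add: box_word_eps_def box_word_phi_def box_word_lower_def op_power_Suc)
    with lower[OF v] show ?thesis by simp
  qed
  then show "map box_value (box_reflect 0 w) = map box_value w"
    "map box_primed (box_reflect 0 w) = toggle_first_one (map box_value w) (map box_primed w)"
    by simp_all
qed

lemma box_word_eqI:
  assumes "map box_value u = map box_value v" "map box_primed u = map box_primed v"
  shows "u = v"
proof -
  have "x = y" if "box_value x = box_value y" "box_primed x = box_primed y" for x y
    using that by (cases x; cases y) auto
  then have "map id u = map id v"
    by (intro map_eq_jointly_injective[OF assms]) simp
  then show ?thesis by simp
qed

lemma box_reflect_commute:
  assumes "Suc i < j"
  shows "box_reflect i (box_reflect j w) = box_reflect j (box_reflect i w)"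
proof (cases "i = 0")
  case True
  have "toggle_first_one (value_reflect j U) P = toggle_first_one U P" for U P
    using assms by (intro toggle_cong value_reflect_frame) auto
  with True show ?thesis
    using assms by (intro box_word_eqI) (simp_all add: box_reflect_pos box_reflect_0)
next
  case False
  then show ?thesis
    using assms by (intro box_word_eqI) (simp_all add: box_reflect_pos value_reflect_commute[OF assms])
qed

lemma box_reflect_braid:
  assumes "0 < i"
  shows "box_reflect i (box_reflect (Suc i) (box_reflect i w)) =
    box_reflect (Suc i) (box_reflect i (box_reflect (Suc i) w))"
  using assms by (intro box_word_eqI) (simp_all add: box_reflect_pos value_reflect_braid)

text \<open>
  With \<open>U\<close> the values of \<open>w\<close> and \<open>V\<close> their image under the involution with
  index 1, both sides have values \<open>U\<close>, and their primes are toggled once at the first 1 of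
  \<open>U\<close> and once at the first 1 of \<open>V\<close>, in opposite orders.
\<close>
lemma box_reflect_quad:
  "box_reflect 0 (box_reflect 1 (box_reflect 0 (box_reflect 1 w))) =
    box_reflect 1 (box_reflect 0 (box_reflect 1 (box_reflect 0 w)))"
  by (intro box_word_eqI)
    (simp_all add: box_reflect_pos box_reflect_0 value_reflect_involution toggle_commute)

section \<open>Tensor powers of the standard crystal\<close>

lemma carrier_standard_crystal:
  "x \<in> carrier (standard_crystal n) \<longleftrightarrow> box_value x \<in> {1..n}"
  by (cases x) (auto simp: standard_crystal_def)

lemma raise_tensor_power_Cons:
  assumes "x \<in> carrier C" "w \<in> carrier (tensor_power C m)"
  shows "raise (tensor_power C (Suc m)) i (x # w) =
      map_option (\<lambda>(b, w). b # w) (tensor_raise C (tensor_power C m) i (x, w))"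
    and "lower (tensor_power C (Suc m)) i (x # w) =
      map_option (\<lambda>(b, w). b # w) (tensor_lower C (tensor_power C m) i (x, w))"
proof -
  have "inj_on (\<lambda>(b, w). b # w) (carrier C \<times> carrier (tensor_power C m))"
    by (auto simp: inj_on_def)
  from inv_into_f_f[OF this, of "(x, w)"]
  have "inv_into (carrier C \<times> carrier (tensor_power C m)) (\<lambda>(b, w). b # w) (x # w) = (x, w)"
    using assms by simp
  then show "raise (tensor_power C (Suc m)) i (x # w) =
      map_option (\<lambda>(b, w). b # w) (tensor_raise C (tensor_power C m) i (x, w))"
    and "lower (tensor_power C (Suc m)) i (x # w) =
      map_option (\<lambda>(b, w). b # w) (tensor_lower C (tensor_power C m) i (x, w))"
    by (simp_all add: relabel_def tensor_def)
qed

lemma carrier_tensor_power_Suc: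
  "carrier (tensor_power C (Suc m)) = (\<lambda>(b, w). b # w) ` (carrier C \<times> carrier (tensor_power C m))"
  by (simp add: relabel_def tensor_def)

text \<open>
  The recursive operators on words are those of the tensor power. The relation is equality
  restricted to the carrier, so that closure of the carrier is part of the statement.
\<close>
lemma tensor_power_simulates:
  assumes "i < n"
  shows "simulates (\<lambda>u v. u = v \<and> u \<in> carrier (tensor_power (standard_crystal n) m))
      (raise (tensor_power (standard_crystal n) m) (Op i)) (box_word_raise i) \<and>
    simulates (\<lambda>u v. u = v \<and> u \<in> carrier (tensor_power (standard_crystal n) m))
      (lower (tensor_power (standard_crystal n) m) (Op i)) (box_word_lower i)"
proof (induction m)
  case 0
  show ?case by (simp add: simulates_def box_word_raise_def box_word_lower_def)
next
  case (Suc m)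
  let ?S = "standard_crystal n" and ?T = "tensor_power (standard_crystal n) m"
  have T: "rel_option (\<lambda>u v. u = v \<and> u \<in> carrier ?T) (raise ?T (Op i) w) (box_word_raise i w)"
    "rel_option (\<lambda>u v. u = v \<and> u \<in> carrier ?T) (lower ?T (Op i) w) (box_word_lower i w)"
    if "w \<in> carrier ?T" for w
    using Suc that by (auto simp: simulates_def)
  then have T_eq: "raise ?T (Op i) w = box_word_raise i w" "lower ?T (Op i) w = box_word_lower i w"
    and T_closed: "box_word_raise i w = Some v \<Longrightarrow> v \<in> carrier ?T"
      "box_word_lower i w = Some v \<Longrightarrow> v \<in> carrier ?T"
    if "w \<in> carrier ?T" for w v
    using that by (force elim: option.rel_cases)+
  \<comment> \<open>The rule for the tensor product compares string lengths in the sense of suprema.\<close>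
  have T_phi: "crystal_phi ?T (Op i) w = enat (box_word_phi i w)" if "w \<in> carrier ?T" for w
    unfolding crystal_phi_def box_words.string_length_down[symmetric]
    by (rule string_length_rel[OF conjunct2[OF Suc]]) (use that in simp)
  have S_eps: "crystal_eps ?S (Op i) x = enat (box_eps i x)" if "0 < i" for x
    using string_crystal.string_length_up[OF box_string_crystal[OF that]]
    by (simp add: crystal_eps_def standard_crystal_def)
  have S: "raise ?S = box_raise" "lower ?S = box_lower" "wt ?S x 1 \<noteq> 0 \<longleftrightarrow> box_value x = 1" for x
    by (cases x; simp add: standard_crystal_def unit_weight_def)+
  have S_closed: "box_value y \<in> {1..n}"
    if "box_raise (Op i) x = Some y \<or> box_lower (Op i) x = Some y" "box_value x \<in> {1..n}" for x y
    using that assms by (cases x) (auto split: if_splits)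
  have zero: "box_raise (Op 0) x = (if box_primed x then Some (Box 1) else None)"
    "box_lower (Op 0) x = (if box_primed x then None else Some (Box' 1))" if "box_value x = 1" for x
    using that by (cases x; simp)+
  have "rel_option (\<lambda>u v. u = v \<and> u \<in> carrier (tensor_power ?S (Suc m)))
      (raise (tensor_power ?S (Suc m)) (Op i) (x # w)) (box_word_raise i (x # w)) \<and>
    rel_option (\<lambda>u v. u = v \<and> u \<in> carrier (tensor_power ?S (Suc m)))
      (lower (tensor_power ?S (Suc m)) (Op i) (x # w)) (box_word_lower i (x # w))"
    if x: "x \<in> carrier ?S" and w: "w \<in> carrier ?T" for x w
  proof (intro conjI)
    have xv: "box_value x \<in> {1..n}" using x by (simp add: carrier_standard_crystal)
    have T_Cons: "rel_option (\<lambda>u v. u = v \<and> u \<in> carrier (tensor_power ?S (Suc m)))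
        (map_option (Cons x) (box_word_raise i w)) (map_option (Cons x) (box_word_raise i w))"
      "rel_option (\<lambda>u v. u = v \<and> u \<in> carrier (tensor_power ?S (Suc m)))
        (map_option (Cons x) (box_word_lower i w)) (map_option (Cons x) (box_word_lower i w))"
      unfolding option.rel_map carrier_tensor_power_Suc
      using T_closed[OF w] x by (auto intro!: option.rel_refl_strong)
    have S_Cons: "rel_option (\<lambda>u v. u = v \<and> u \<in> carrier (tensor_power ?S (Suc m)))
        (map_option (\<lambda>y. y # w) (box_raise (Op i) x)) (map_option (\<lambda>y. y # w) (box_raise (Op i) x))"
      "rel_option (\<lambda>u v. u = v \<and> u \<in> carrier (tensor_power ?S (Suc m)))
        (map_option (\<lambda>y. y # w) (box_lower (Op i) x)) (map_option (\<lambda>y. y # w) (box_lower (Op i) x))"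
      unfolding option.rel_map carrier_tensor_power_Suc
      using S_closed[OF _ xv] w by (auto intro!: option.rel_refl_strong simp: carrier_standard_crystal)
    show "rel_option (\<lambda>u v. u = v \<and> u \<in> carrier (tensor_power ?S (Suc m)))
      (raise (tensor_power ?S (Suc m)) (Op i) (x # w)) (box_word_raise i (x # w))"
    proof -
      have "raise (tensor_power ?S (Suc m)) (Op i) (x # w) = box_word_raise i (x # w) \<and>
        box_word_raise i (x # w) \<in> {map_option (Cons x) (box_word_raise i w), map_option (\<lambda>y. y # w) (box_raise (Op i) x)}"
        unfolding raise_tensor_power_Cons[OF x w]
        using T_eq[OF w] T_phi[OF w] S_eps[of x] zero[of x]
        by (auto simp: S[simplified] opt_tensor_def option.map_comp comp_def map_conv_bind_option box_word_raise_def box_word_phi_def)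
      with T_Cons S_Cons show ?thesis by auto
    qed
    show "rel_option (\<lambda>u v. u = v \<and> u \<in> carrier (tensor_power ?S (Suc m)))
      (lower (tensor_power ?S (Suc m)) (Op i) (x # w)) (box_word_lower i (x # w))"
    proof -
      have "lower (tensor_power ?S (Suc m)) (Op i) (x # w) = box_word_lower i (x # w) \<and>
        box_word_lower i (x # w) \<in> {map_option (Cons x) (box_word_lower i w), map_option (\<lambda>y. y # w) (box_lower (Op i) x)}"
        unfolding raise_tensor_power_Cons[OF x w]
        using T_eq[OF w] T_phi[OF w] S_eps[of x] zero[of x]
        by (auto simp: S[simplified] opt_tensor_def option.map_comp comp_def map_conv_bind_option box_word_lower_def box_word_phi_def)
      with T_Cons S_Cons show ?thesis by auto
    qed
  qed
  then show ?case
    by (auto simp: simulates_def carrier_tensor_power_Suc simp del: tensor_power.simps)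
qed

section \<open>Words in the generators of the hyperoctahedral group\<close>

text \<open>
  Maps on a set that satisfy the Coxeter relations of type $\mathsf{BC}_n$. The relation
  \<open>sim\<close> compares two words in the generators by their effect on that set, so that the
  same rewriting of words serves for permutations and for crystal operators.
\<close>
locale bc_relations =
  fixes n :: nat and s :: "nat \<Rightarrow> 'y \<Rightarrow> 'y" and Y :: "'y set"
  assumes closed: "\<lbrakk>i < n; y \<in> Y\<rbrakk> \<Longrightarrow> s i y \<in> Y"
    and involution: "\<lbrakk>i < n; y \<in> Y\<rbrakk> \<Longrightarrow> s i (s i y) = y"
    and commute: "\<lbrakk>Suc i < j; j < n; y \<in> Y\<rbrakk> \<Longrightarrow> s i (s j y) = s j (s i y)"
    and braid: "\<lbrakk>1 \<le> i; Suc i < n; y \<in> Y\<rbrakk> \<Longrightarrow> s i (s (Suc i) (s i y)) = s (Suc i) (s i (s (Suc i) y))"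
    and quad: "\<lbrakk>1 < n; y \<in> Y\<rbrakk> \<Longrightarrow> s 0 (s 1 (s 0 (s 1 y))) = s 1 (s 0 (s 1 (s 0 y)))"
begin

definition sim :: "nat list \<Rightarrow> nat list \<Rightarrow> bool" (infix \<open>\<approx>\<close> 50)
  where "L \<approx> M \<longleftrightarrow> (\<forall>y\<in>Y. foldr s L y = foldr s M y)"

lemma sim_refl [simp]: "L \<approx> L"
  by (simp add: sim_def)

lemma sim_trans [trans]: "L \<approx> M \<Longrightarrow> M \<approx> N \<Longrightarrow> L \<approx> N"
  by (simp add: sim_def)

lemma foldr_closed: "set L \<subseteq> {..<n} \<Longrightarrow> y \<in> Y \<Longrightarrow> foldr s L y \<in> Y"
  by (induction L) (auto intro: closed)

lemma sim_context: "L \<approx> M \<Longrightarrow> set B \<subseteq> {..<n} \<Longrightarrow> A @ L @ B \<approx> A @ M @ B"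
  by (simp add: sim_def foldr_closed)

lemma sim_rev: "set L \<subseteq> {..<n} \<Longrightarrow> rev L @ L \<approx> []"
proof (induction L)
  case (Cons i L)
  then have "rev (i # L) @ (i # L) \<approx> rev L @ L"
    by (simp add: sim_def involution foldr_closed)
  with Cons show ?case using sim_trans by simp
qed simp

lemma sim_cancel: "i < n \<Longrightarrow> set L \<subseteq> {..<n} \<Longrightarrow> i # i # L \<approx> L"
  by (simp add: sim_def involution foldr_closed)

lemma pass_through:
  assumes "j < n" "\<And>x. x \<in> set L \<Longrightarrow> x < n \<and> (Suc x < j \<or> Suc j < x)"
  shows "j # L \<approx> L @ [j]"
  using assms(2)
proof (induction L)
  case (Cons x L)
  have "foldr s (j # x # L) y = foldr s (x # L @ [j]) y" if "y \<in> Y" for y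
  proof -
    have L: "foldr s L y \<in> Y"
      using Cons.prems that by (intro foldr_closed) auto
    have "s j (s x (foldr s L y)) = s x (s j (foldr s L y))"
      using Cons.prems[of x] assms(1) commute[OF _ _ L] by auto
    moreover have "s j (foldr s L y) = foldr s (L @ [j]) y"
      using Cons that by (simp add: sim_def)
    ultimately show ?thesis by simp
  qed
  then show ?case by (simp add: sim_def)
qed simp

lemma upt_split3: "v \<le> j \<Longrightarrow> Suc j < m \<Longrightarrow> [v..<m] = [v..<j] @ [j, Suc j] @ [Suc (Suc j)..<m]"
  using upt_add_eq_append[of v j "m - j"] by (simp add: upt_conv_Cons)

text \<open>
  A generator moves through an ascending run and comes out with its index lowered by one: it
  commutes up to its neighbour, is exchanged there by a braid relation, and commutes with the rest.
\<close>
lemma pass_up: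
  assumes "v \<le> j" "1 \<le> j" "Suc j < m" "m \<le> n"
  shows "Suc j # [v..<m] \<approx> [v..<m] @ [j]"
proof -
  have "[] @ (Suc j # [v..<j]) @ ([j, Suc j] @ [Suc (Suc j)..<m]) \<approx>
    [] @ ([v..<j] @ [Suc j]) @ ([j, Suc j] @ [Suc (Suc j)..<m])"
    using assms by (intro sim_context pass_through) auto
  moreover have "[v..<j] @ [Suc j, j, Suc j] @ [Suc (Suc j)..<m] \<approx>
    [v..<j] @ [j, Suc j, j] @ [Suc (Suc j)..<m]"
    using assms by (intro sim_context) (auto simp: sim_def braid)
  moreover have "([v..<j] @ [j, Suc j]) @ (j # [Suc (Suc j)..<m]) @ [] \<approx>
    ([v..<j] @ [j, Suc j]) @ ([Suc (Suc j)..<m] @ [j]) @ []"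
    using assms by (intro sim_context pass_through) auto
  ultimately show ?thesis
    unfolding upt_split3[OF assms(1,3)] by (simp add: sim_def)
qed

lemma pass_down:
  assumes "1 \<le> j" "Suc j < u" "u \<le> n"
  shows "j # rev [1..<u] \<approx> rev [1..<u] @ [Suc j]"
proof -
  have "[] @ (j # rev [Suc (Suc j)..<u]) @ ([Suc j, j] @ rev [1..<j]) \<approx>
    [] @ (rev [Suc (Suc j)..<u] @ [j]) @ ([Suc j, j] @ rev [1..<j])"
    using assms by (intro sim_context pass_through) auto
  moreover have "rev [Suc (Suc j)..<u] @ [j, Suc j, j] @ rev [1..<j] \<approx>
    rev [Suc (Suc j)..<u] @ [Suc j, j, Suc j] @ rev [1..<j]"
    using assms by (intro sim_context) (auto simp: sim_def braid)
  moreover have "(rev [Suc (Suc j)..<u] @ [Suc j, j]) @ (Suc j # rev [1..<j]) @ [] \<approx>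
    (rev [Suc (Suc j)..<u] @ [Suc j, j]) @ (rev [1..<j] @ [Suc j]) @ []"
    using assms by (intro sim_context pass_through) auto
  ultimately show ?thesis
    unfolding upt_split3[OF assms(1,2)] by (simp add: sim_def)
qed

text \<open>
  The step of the rewriting that rests on the relation of length four.
\<close>
lemma pass_zero:
  assumes "2 \<le> u" "u \<le> m" "m \<le> n"
  shows "0 # rev [1..<u] @ [0..<m] \<approx> rev [1..<u] @ [0..<m] @ [0]"
proof -
  have u: "rev [1..<u] = rev [2..<u] @ [1]" and m: "[0..<m] = [0, 1] @ [2..<m]"
    using assms by (auto simp: upt_conv_Cons numeral_2_eq_2)
  have "[] @ (0 # rev [2..<u]) @ ([1, 0, 1] @ [2..<m]) \<approx>
    [] @ (rev [2..<u] @ [0]) @ ([1, 0, 1] @ [2..<m])"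
    using assms by (intro sim_context pass_through) auto
  moreover have "rev [2..<u] @ [0, 1, 0, 1] @ [2..<m] \<approx> rev [2..<u] @ [1, 0, 1, 0] @ [2..<m]"
    using assms quad by (intro sim_context) (auto simp: sim_def)
  moreover have "(rev [2..<u] @ [1, 0, 1]) @ (0 # [2..<m]) @ [] \<approx>
    (rev [2..<u] @ [1, 0, 1]) @ ([2..<m] @ [0]) @ []"
    using assms by (intro sim_context pass_through) auto
  ultimately show ?thesis
    unfolding u m by (simp add: sim_def)
qed

end

text \<open>
  Shortest representatives of the cosets of the subgroup generated by the first
  \<open>m - 1\<close> generators, inside the group generated by the first \<open>m\<close>. The
  representative with parameter \<open>v\<close> sends \<open>m\<close> to \<open>v\<close>, see
  \<open>BC_eval_coset_word\<close>.
\<close>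
definition coset_word :: "nat \<Rightarrow> int \<Rightarrow> nat list"
  where "coset_word m v = (if 0 < v then [nat v..<m] else rev [1..<nat (- v)] @ [0..<m])"

lemma set_coset_word: "0 < m \<Longrightarrow> \<bar>v\<bar> \<le> int m \<Longrightarrow> set (coset_word m v) \<subseteq> {..<m}"
  by (auto simp: coset_word_def)

context bc_relations
begin

text \<open>
  A generator either permutes the cosets, by acting on \<open>v\<close>, or it moves through the
  representative and becomes a generator of the subgroup.
\<close>
lemma coset_step:
  assumes "j < m" "m \<le> n" "v \<noteq> 0" "\<bar>v\<bar> \<le> int m"
  shows "\<exists>v' M. v' \<noteq> 0 \<and> \<bar>v'\<bar> \<le> int m \<and> set M \<subseteq> {..<m - 1} \<and>
    j # coset_word m v \<approx> coset_word m v' @ M"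
proof (cases "0 < v")
  case True
  define u where "u = nat v"
  have u: "v = int u" "1 \<le> u" "u \<le> m" and c: "coset_word m v = [u..<m]"
    using True assms by (auto simp: u_def coset_word_def)
  consider "j = u" | "Suc j = u" "1 \<le> j" | "Suc j = u" "j = 0" | "Suc j < u" | "u < j" by linarith
  then show ?thesis
  proof cases
    case 1
    then have "j # [u..<m] \<approx> [Suc u..<m]"
      using assms by (auto simp: sim_def upt_conv_Cons involution intro!: foldr_closed involution)
    then show ?thesis
      using 1 assms u by (intro exI[of _ "int (Suc u)"] exI[of _ "[]"])
        (auto simp: c coset_word_def nat_add_distrib)
  next
    case 2
    then have "j # coset_word m v = coset_word m (int j)"
      unfolding c using assms by (simp add: coset_word_def upt_conv_Cons)
    then show ?thesis
      using 2 assms by (intro exI[of _ "int j"] exI[of _ "[]"]) simp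
  next
    case 3
    then have "j # coset_word m v = coset_word m (- 1)"
      unfolding c using assms by (simp add: coset_word_def upt_conv_Cons)
    then show ?thesis
      using 3 assms by (intro exI[of _ "- 1"] exI[of _ "[]"]) simp
  next
    case 4
    then have "j # coset_word m v \<approx> coset_word m v @ [j]"
      unfolding c using assms by (intro pass_through) auto
    then show ?thesis
      using 4 assms u by (intro exI[of _ v] exI[of _ "[j]"]) auto
  next
    case 5
    then have "Suc (j - 1) # coset_word m v \<approx> coset_word m v @ [j - 1]"
      unfolding c using assms u by (intro pass_up) auto
    then show ?thesis
      using 5 assms u by (intro exI[of _ v] exI[of _ "[j - 1]"]) auto
  qed
next
  case False
  define u where "u = nat (- v)"
  have u: "v = - int u" "1 \<le> u" "u \<le> m" and c: "coset_word m v = rev [1..<u] @ [0..<m]"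
    using False assms by (auto simp: u_def coset_word_def)
  consider "j = u" | "Suc j = u" "1 \<le> j" | "Suc j = u" "j = 0" | "1 \<le> j" "Suc j < u"
    | "j = 0" "2 \<le> u" | "u < j" using u by linarith
  then show ?thesis
  proof cases
    case 1
    then have "j # coset_word m v = coset_word m (- int (Suc u))"
      using u by (simp add: c coset_word_def nat_add_distrib)
    then show ?thesis
      using 1 assms u by (intro exI[of _ "- int (Suc u)"] exI[of _ "[]"]) auto
  next
    case 2
    then have "rev [1..<u] = j # rev [1..<j]" by auto
    then have "coset_word m v = j # coset_word m (- int j)"
      unfolding c using 2 by (simp add: coset_word_def)
    then have "j # coset_word m v \<approx> coset_word m (- int j)"
      using 2 assms set_coset_word[of m "- int j"] by (auto intro!: sim_cancel)
    then show ?thesis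
      using 2 assms by (intro exI[of _ "- int j"] exI[of _ "[]"]) auto
  next
    case 3
    then have "rev [1..<u] @ [0..<m] = j # [1..<m]"
      using assms by (simp add: upt_conv_Cons)
    then have "coset_word m v = j # coset_word m 1"
      unfolding c by (simp add: coset_word_def)
    then have "j # coset_word m v \<approx> coset_word m 1"
      using 3 assms set_coset_word[of m 1] by (auto intro!: sim_cancel)
    then show ?thesis
      using 3 assms by (intro exI[of _ 1] exI[of _ "[]"]) auto
  next
    case 4
    have "[] @ (j # rev [1..<u]) @ [0..<m] \<approx> [] @ (rev [1..<u] @ [Suc j]) @ [0..<m]"
      using 4 u assms by (intro sim_context pass_down) auto
    moreover have "rev [1..<u] @ (Suc j # [0..<m]) @ [] \<approx> rev [1..<u] @ ([0..<m] @ [j]) @ []"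
      using 4 u assms by (intro sim_context pass_up) auto
    ultimately have "j # coset_word m v \<approx> coset_word m v @ [j]"
      unfolding c by (simp add: sim_def)
    then show ?thesis
      using 4 assms u by (intro exI[of _ v] exI[of _ "[j]"]) auto
  next
    case 5
    then have "j # coset_word m v \<approx> coset_word m v @ [j]"
      unfolding c using pass_zero[of u m] u assms by simp
    then show ?thesis
      using 5 assms u by (intro exI[of _ v] exI[of _ "[j]"]) auto
  next
    case 6
    have "[] @ (j # rev [1..<u]) @ [0..<m] \<approx> [] @ (rev [1..<u] @ [j]) @ [0..<m]"
      using 6 u assms by (intro sim_context pass_through) auto
    moreover have "rev [1..<u] @ (Suc (j - 1) # [0..<m]) @ [] \<approx> rev [1..<u] @ ([0..<m] @ [j - 1]) @ []"
      using 6 u assms by (intro sim_context pass_up) auto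
    moreover have "Suc (j - 1) = j" using 6 by simp
    ultimately have "j # coset_word m v \<approx> coset_word m v @ [j - 1]"
      unfolding c by (simp add: sim_def)
    then show ?thesis
      using 6 assms u by (intro exI[of _ v] exI[of _ "[j - 1]"]) auto
  qed
qed

lemma coset_factorization:
  assumes "0 < m" "m \<le> n" "set L \<subseteq> {..<m}"
  shows "\<exists>v M. v \<noteq> 0 \<and> \<bar>v\<bar> \<le> int m \<and> set M \<subseteq> {..<m - 1} \<and> L \<approx> coset_word m v @ M"
  using assms(3)
proof (induction L)
  case Nil
  have "coset_word m (int m) = []" using assms(1) by (simp add: coset_word_def)
  then show ?case using assms(1) by (intro exI[of _ "int m"] exI[of _ "[]"]) simp
next
  case (Cons j L)
  then obtain v M where vM: "v \<noteq> 0" "\<bar>v\<bar> \<le> int m" "set M \<subseteq> {..<m - 1}" "L \<approx> coset_word m v @ M"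
    by auto
  obtain v' M' where v'M': "v' \<noteq> 0" "\<bar>v'\<bar> \<le> int m" "set M' \<subseteq> {..<m - 1}"
    "j # coset_word m v \<approx> coset_word m v' @ M'"
    using coset_step[of j m v] Cons.prems assms vM by auto
  have "[j] @ L @ [] \<approx> [j] @ (coset_word m v @ M) @ []"
    by (intro sim_context vM) simp
  moreover have "[] @ (j # coset_word m v) @ M \<approx> [] @ (coset_word m v' @ M') @ M"
    using vM assms by (intro sim_context v'M') auto
  ultimately have "j # L \<approx> coset_word m v' @ (M' @ M)"
    by (simp add: sim_def)
  then show ?case
    using vM v'M' by (intro exI[of _ v'] exI[of _ "M' @ M"]) auto
qed

end

section \<open>The hyperoctahedral group as signed permutations\<close>

lemma BC_gen_0: "BC_gen 0 z = (if z = 1 then - 1 else if z = - 1 then 1 else z)"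
  by (auto simp: BC_gen_def Transposition.transpose_def)

lemma BC_gen_pos:
  "0 < i \<Longrightarrow> BC_gen i z =
    (if z = int i then int i + 1 else if z = int i + 1 then int i
     else if z = - int i then - int i - 1 else if z = - int i - 1 then - int i else z)"
  by (auto simp: BC_gen_def Transposition.transpose_def)

lemma BC_gen_odd: "BC_gen i (- z) = - BC_gen i z"
  by (cases "i = 0") (auto simp: BC_gen_0 BC_gen_pos)

lemma BC_gen_involution: "BC_gen i (BC_gen i z) = z"
  by (cases "i = 0") (auto simp: BC_gen_0 BC_gen_pos)

lemma BC_gen_fixes: "int i + 1 < z \<Longrightarrow> BC_gen i z = z"
  by (cases "i = 0") (auto simp: BC_gen_0 BC_gen_pos)

lemma BC_gen_relations: "bc_relations n BC_gen UNIV"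
proof
  show "BC_gen i (BC_gen j z) = BC_gen j (BC_gen i z)" if "Suc i < j" for i j z
    using that by (cases "i = 0") (auto simp: BC_gen_0 BC_gen_pos)
  show "BC_gen i (BC_gen (Suc i) (BC_gen i z)) = BC_gen (Suc i) (BC_gen i (BC_gen (Suc i) z))"
    if "1 \<le> i" for i z
  proof -
    consider "z = int i" | "z = int i + 1" | "z = int i + 2" | "z = - int i" | "z = - int i - 1"
      | "z = - int i - 2" | "z \<notin> {int i, int i + 1, int i + 2, - int i, - int i - 1, - int i - 2}"
      by blast
    then show ?thesis
      using that by cases (simp_all add: BC_gen_pos)
  qed
  show "BC_gen 0 (BC_gen 1 (BC_gen 0 (BC_gen 1 z))) = BC_gen 1 (BC_gen 0 (BC_gen 1 (BC_gen 0 z)))" for z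
  proof -
    consider "z = 1" | "z = 2" | "z = - 1" | "z = - 2" | "z \<notin> {1, 2, - 1, - 2}" by blast
    then show ?thesis
      by cases (simp_all add: BC_gen_0 BC_gen_pos)
  qed
qed (simp_all add: BC_gen_involution)

abbreviation BC_eval :: "nat list \<Rightarrow> int \<Rightarrow> int"
  where "BC_eval \<equiv> foldr BC_gen"

lemma BC_eval_fixes: "set L \<subseteq> {..<m} \<Longrightarrow> int m < z \<Longrightarrow> BC_eval L z = z"
  by (induction L) (auto simp: BC_gen_fixes)

lemma BC_eval_odd: "BC_eval L (- z) = - BC_eval L z"
  by (induction L) (auto simp: BC_gen_odd)

lemma BC_eval_upt: "1 \<le> u \<Longrightarrow> u \<le> m \<Longrightarrow> BC_eval [u..<m] (int m) = int u"
proof (induction m)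
  case (Suc m)
  show ?case
  proof (cases "u = Suc m")
    case False
    then have "BC_gen m (int (Suc m)) = int m" using Suc by (simp add: BC_gen_pos)
    with Suc False show ?thesis by simp
  qed simp
qed simp

lemma BC_eval_rev_upt: "1 \<le> u \<Longrightarrow> BC_eval (rev [1..<u]) (- 1) = - int u"
proof (induction u)
  case (Suc u)
  then show ?case by (cases "u = 0") (simp_all add: BC_gen_pos)
qed simp

lemma BC_eval_coset_word:
  assumes "v \<noteq> 0" "\<bar>v\<bar> \<le> int m" "0 < m"
  shows "BC_eval (coset_word m v) (int m) = v"
proof (cases "0 < v")
  case True
  then show ?thesis using assms BC_eval_upt[of "nat v" m] by (auto simp: coset_word_def)
next
  case False
  have "BC_eval [0..<m] (int m) = - 1"
    using assms BC_eval_upt[of 1 m] by (simp add: upt_conv_Cons BC_gen_0)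
  then show ?thesis
    using False assms BC_eval_rev_upt[of "nat (- v)"] by (auto simp: coset_word_def)
qed

lemma BC_eval_rev: "BC_eval (rev L) (BC_eval L z) = z" "BC_eval L (BC_eval (rev L) z) = z"
proof -
  show *: "BC_eval (rev L) (BC_eval L z) = z" for L z
    by (induction L) (auto simp: BC_gen_involution)
  show "BC_eval L (BC_eval (rev L) z) = z"
    using *[of "rev L"] by simp
qed

lemma BC_eval_in_W: "set L \<subseteq> {..<n} \<Longrightarrow> BC_eval L \<in> carrier (W_BC n)"
  by (auto simp: W_BC_def BC_eval_odd BC_eval_fixes BC_eval_rev intro!: o_bij[of "BC_eval (rev L)"])

text \<open>
  A coset word corrects the image of the largest letter, which leaves a signed permutation of
  fewer letters.
\<close>
lemma W_generated: "w \<in> carrier (W_BC n) \<Longrightarrow> \<exists>L. set L \<subseteq> {..<n} \<and> BC_eval L = w"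
proof (induction n arbitrary: w)
  case 0
  have "w z = z" for z
  proof -
    have "w 0 = 0" using 0 by (simp add: W_BC_def) (metis add.inverse_neutral equal_neg_zero)
    moreover have "w z = z" if "0 < z" for z using 0 that by (simp add: W_BC_def)
    moreover have "w z = - w (- z)" using 0 by (simp add: W_BC_def)
    ultimately show ?thesis by (cases "0 < z"; cases "z = 0") auto
  qed
  then show ?case by (intro exI[of _ "[]"]) auto
next
  case (Suc n)
  have w: "bij w" "\<And>i. w (- i) = - w i" "\<And>i. int (Suc n) < i \<Longrightarrow> w i = i"
    using Suc.prems by (auto simp: W_BC_def)
  define v where "v = w (int (Suc n))"
  have inj: "w x = w y \<Longrightarrow> x = y" for x y
    using w(1) by (simp add: bij_def inj_eq)
  have "w 0 = 0" using w(2)[of 0] by simp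
  then have v0: "v \<noteq> 0" using inj[of "int (Suc n)" 0] by (auto simp: v_def)
  have v1: "\<bar>v\<bar> \<le> int (Suc n)"
  proof (rule ccontr)
    assume "\<not> ?thesis"
    then have "w \<bar>v\<bar> = \<bar>v\<bar>" "int (Suc n) < \<bar>v\<bar>" using w(3) by auto
    moreover from this have "w v = v" using w(2)[of v] by (cases "0 \<le> v") auto
    ultimately show False using inj[of v "int (Suc n)"] by (simp add: v_def)
  qed
  let ?c = "coset_word (Suc n) v"
  have c: "set ?c \<subseteq> {..<Suc n}" using v1 by (intro set_coset_word) auto
  define w' where "w' = BC_eval (rev ?c) \<circ> w"
  have "w' \<in> carrier (W_BC n)"
  proof -
    have "BC_eval (rev ?c) \<in> carrier (W_BC (Suc n))"
      using c by (intro BC_eval_in_W) simp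
    then have "bij w'" "\<And>i. w' (- i) = - w' i" "\<And>i. int (Suc n) < i \<Longrightarrow> w' i = i"
      using w by (auto simp: w'_def W_BC_def intro: bij_comp)
    moreover have "w' (int (Suc n)) = int (Suc n)"
    proof -
      have "BC_eval ?c (int (Suc n)) = v" using v0 v1 by (intro BC_eval_coset_word) auto
      then show ?thesis using BC_eval_rev(1)[of ?c "int (Suc n)"] by (simp add: w'_def v_def)
    qed
    ultimately show ?thesis
      by (simp add: W_BC_def) (metis add.commute zless_add1_eq linorder_neqE_linordered_idom zless_imp_add1_zle le_less)
  qed
  then obtain L where L: "set L \<subseteq> {..<n}" "BC_eval L = w'" using Suc.IH by blast
  have "BC_eval (?c @ L) = w"
    using L(2) by (auto simp: fun_eq_iff w'_def BC_eval_rev)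
  then show ?case using c L(1) by (intro exI[of _ "?c @ L"]) auto
qed

lemma group_W_BC: "group (W_BC n)"
proof (rule groupI)
  fix x assume x: "x \<in> carrier (W_BC n)"
  then obtain L where L: "set L \<subseteq> {..<n}" "BC_eval L = x" using W_generated by blast
  then show "\<exists>y\<in>carrier (W_BC n). y \<otimes>\<^bsub>W_BC n\<^esub> x = \<one>\<^bsub>W_BC n\<^esub>"
    using BC_eval_in_W[of "rev L" n] by (intro bexI[of _ "BC_eval (rev L)"])
      (auto simp: fun_eq_iff W_BC_def BC_eval_rev simp flip: L(2))
qed (auto simp: W_BC_def bij_comp)

section \<open>The relations present the group\<close>

context bc_relations
begin

text \<open>
  Letting the generators act on integers and on \<open>Y\<close> at the same time yields a single
  factorization that is valid for both.
\<close>
lemma relations_with_permutations: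
  "bc_relations n (\<lambda>i (z, y). (BC_gen i z, s i y)) (UNIV \<times> Y)"
proof -
  interpret g: bc_relations n BC_gen UNIV by (rule BC_gen_relations)
  show ?thesis
    by unfold_locales
      (auto simp: closed involution g.involution braid quad[simplified] g.quad[simplified] intro!: commute g.commute g.braid)
qed

lemma foldr_pair:
  "foldr (\<lambda>i (z, y). (BC_gen i z, s i y)) L (z, y) = (BC_eval L z, foldr s L y)"
  by (induction L) auto

text \<open>
  The image of the largest letter shows that the coset word in the factorization is empty, so one
  generator is removed and induction applies.
\<close>
lemma trivial_word:
  assumes "BC_eval L = id" "set L \<subseteq> {..<m}" "m \<le> n"
  shows "L \<approx> []"
  using assms
proof (induction m arbitrary: L)
  case (Suc m)
  interpret p: bc_relations n "\<lambda>i (z, y). (BC_gen i z, s i y)" "UNIV \<times> Y"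
    by (rule relations_with_permutations)
  show ?case
  proof (cases "Y = {}")
    case False
    obtain v M where vM: "v \<noteq> 0" "\<bar>v\<bar> \<le> int (Suc m)" "set M \<subseteq> {..<m}"
      "p.sim L (coset_word (Suc m) v @ M)"
      using p.coset_factorization[of "Suc m" L] Suc.prems by auto
    then have eval: "BC_eval L z = BC_eval (coset_word (Suc m) v @ M) z"
      and act: "L \<approx> coset_word (Suc m) v @ M" for z
      using False by (auto simp: p.sim_def sim_def foldr_pair simp del: foldr_append)
    have "BC_eval M (int (Suc m)) = int (Suc m)"
      using vM(3) by (intro BC_eval_fixes) auto
    then have "v = int (Suc m)"
      using eval[of "int (Suc m)"] BC_eval_coset_word[OF vM(1,2)] Suc.prems(1) by simp
    then have c: "coset_word (Suc m) v = []"
      by (simp add: coset_word_def nat_add_distrib)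
    have "BC_eval M = id" using eval Suc.prems(1) c by (auto simp: fun_eq_iff)
    then have "M \<approx> []" using Suc.IH vM(3) Suc.prems(3) by simp
    with act c show ?thesis using sim_trans by simp
  qed (use sim_def in simp)
qed simp

theorem action_depends_only_on_permutation:
  assumes "BC_eval L = BC_eval M" "set L \<subseteq> {..<n}" "set M \<subseteq> {..<n}"
  shows "L \<approx> M"
proof -
  have "BC_eval (L @ rev M) = id"
    using assms(1) by (auto simp: fun_eq_iff BC_eval_rev)
  then have "[] @ (L @ rev M) @ M \<approx> [] @ [] @ M"
    using assms by (intro sim_context trivial_word[of _ n]) auto
  moreover have "L @ (rev M @ M) @ [] \<approx> L @ [] @ []"
    using assms by (intro sim_context sim_rev) auto
  ultimately show ?thesis by (auto simp: sim_def)
qed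

end

section \<open>Relations in normal crystals\<close>

text \<open>
  A component contains both ends of an edge or neither, so the operators restrict to it.
\<close>
lemma full_subcrystalE:
  assumes "X \<in> full_subcrystals n C"
  obtains A where "X = C\<lparr>carrier := A\<rparr>" "A \<subseteq> carrier C"
    "\<And>i b c. \<lbrakk>i < n; b \<in> carrier C; c \<in> carrier C; lower C (Op i) b = Some c\<rbrakk> \<Longrightarrow> b \<in> A \<longleftrightarrow> c \<in> A"
proof -
  let ?r = "\<lambda>x y. \<exists>i\<in>q_plus_indices n. crystal_edge C i x y"
  obtain b0 where b0: "b0 \<in> carrier C" "X = C\<lparr>carrier := {c. equivclp ?r b0 c}\<rparr>"
    using assms by (auto simp: full_subcrystals_def)
  show thesis
  proof (rule that[OF b0(2)])
    have "c \<in> carrier C" if "equivclp ?r b0 c" for c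
      using that b0(1) by (induction rule: equivclp_induct) (simp_all, auto simp: crystal_edge_def)
    then show "{c. equivclp ?r b0 c} \<subseteq> carrier C" by blast
    fix i b c
    assume "i < n" "b \<in> carrier C" "c \<in> carrier C" "lower C (Op i) b = Some c"
    moreover have "Op i \<in> q_plus_indices n"
      using \<open>i < n\<close> by (cases "i = 0") (auto simp: q_plus_indices_def q_indices_def gl_indices_def)
    ultimately have "?r b c" by (auto simp: crystal_edge_def)
    then show "b \<in> {c. equivclp ?r b0 c} \<longleftrightarrow> c \<in> {c. equivclp ?r b0 c}"
      using equivclp_into_equivclp[of ?r b0 b c] equivclp_into_equivclp[of ?r b0 c b] by blast
  qed
qed

lemma (in q_plus_crystal) Op_closed:
  assumes "i < n" "b \<in> carrier C"
  shows "raise C (Op i) b = Some c \<Longrightarrow> c \<in> carrier C"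
    and "lower C (Op i) b = Some c \<Longrightarrow> c \<in> carrier C"
  using assms gl_raise_closed[of i b c] gl_lower_closed[of i b c] zero_raise_closed[of b c] zero_lower_closed[of b c]
  by (cases "i = 0"; simp)+

lemma (in q_plus_crystal) Op_inverse:
  assumes "i < n" "b \<in> carrier C" "c \<in> carrier C"
  shows "raise C (Op i) b = Some c \<longleftrightarrow> lower C (Op i) c = Some b"
  using assms S1_inverse[of i b c] Q1_inverse[of b c] by (cases "i = 0") simp_all

text \<open>
  An isomorphism matches edges, which are given by the lowering operators. Since both crystals are
  closed under the operators, which are partial inverses of each other, it respects undefined
  values and raising operators as well, and hence reflections.
\<close>
lemma normal_crystal_model:
  assumes "normal_q_plus_crystal n B" "b \<in> carrier B"
  obtains A f where "b \<in> A" "A \<subseteq> carrier B" "inj_on f A"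
    "\<And>i x. \<lbrakk>i < n; x \<in> A\<rbrakk> \<Longrightarrow> sigma B (Op i) x \<in> A"
    "\<And>i x. \<lbrakk>i < n; x \<in> A\<rbrakk> \<Longrightarrow> f (sigma B (Op i) x) = box_reflect i (f x)"
proof -
  interpret q_plus_crystal n B
    using assms(1) by (simp add: normal_q_plus_crystal_def)
  let ?X = "B\<lparr>carrier := {c. equivclp (\<lambda>x y. \<exists>i\<in>q_plus_indices n. crystal_edge B i x y) b c}\<rparr>"
  have X: "?X \<in> full_subcrystals n B"
    using assms(2) by (auto simp: full_subcrystals_def)
  obtain m Y f where Y: "Y \<in> full_subcrystals n (tensor_power (standard_crystal n) m)"
    and f: "crystal_isomorphism n ?X Y f"
    using assms(1) X unfolding normal_q_plus_crystal_def by blast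
  let ?T = "tensor_power (standard_crystal n) m"
  obtain A where A: "?X = B\<lparr>carrier := A\<rparr>" "A \<subseteq> carrier B"
    "\<And>i b c. \<lbrakk>i < n; b \<in> carrier B; c \<in> carrier B; lower B (Op i) b = Some c\<rbrakk> \<Longrightarrow> b \<in> A \<longleftrightarrow> c \<in> A"
    using full_subcrystalE[OF X] by blast
  obtain D where D: "Y = ?T\<lparr>carrier := D\<rparr>" "D \<subseteq> carrier ?T"
    "\<And>i b c. \<lbrakk>i < n; b \<in> carrier ?T; c \<in> carrier ?T; lower ?T (Op i) b = Some c\<rbrakk> \<Longrightarrow> b \<in> D \<longleftrightarrow> c \<in> D"
    using full_subcrystalE[OF Y] by blast
  have bA: "b \<in> A" using arg_cong[OF A(1), of carrier] by auto
  have bij: "bij_betw f A D"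
    using f unfolding A(1) D(1) by (simp add: crystal_isomorphism_def)
  have edge: "lower B (Op i) x = Some y \<longleftrightarrow> lower ?T (Op i) (f x) = Some (f y)"
    if "i < n" "x \<in> A" "y \<in> A" for i x y
  proof -
    have "Op i \<in> q_plus_indices n"
      using that(1) by (cases "i = 0") (auto simp: q_plus_indices_def q_indices_def gl_indices_def)
    then have "crystal_edge (B\<lparr>carrier := A\<rparr>) (Op i) x y \<longleftrightarrow> crystal_edge (?T\<lparr>carrier := D\<rparr>) (Op i) (f x) (f y)"
      using f that unfolding A(1) D(1) by (simp add: crystal_isomorphism_def)
    moreover have "f x \<in> D" "f y \<in> D" using bij that by (auto dest: bij_betwE)
    ultimately show ?thesis using that by (simp add: crystal_edge_def)
  qed
  have T: "rel_option (\<lambda>u v. u = v \<and> u \<in> carrier ?T) (raise ?T (Op i) w) (box_word_raise i w)"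
    "rel_option (\<lambda>u v. u = v \<and> u \<in> carrier ?T) (lower ?T (Op i) w) (box_word_lower i w)"
    if "i < n" "w \<in> D" for i w
    using tensor_power_simulates[OF that(1), of m] that(2) D(2) by (auto simp: simulates_def)
  then have T_eq: "lower ?T (Op i) w = box_word_lower i w"
    and T_closed: "box_word_raise i w = Some v \<Longrightarrow> v \<in> carrier ?T"
      "box_word_lower i w = Some v \<Longrightarrow> v \<in> carrier ?T"
    if "i < n" "w \<in> D" for i w v
    using that by (force elim: option.rel_cases)+
  have T_eq': "lower ?T (Op i) w = box_word_lower i w" if "i < n" "w \<in> carrier ?T" for i w
    using tensor_power_simulates[OF that(1), of m] that(2)
    by (auto simp: simulates_def elim!: allE[of _ w] option.rel_cases)
  \<comment> \<open>Off the component the map \<open>f\<close> carries no information, hence the restriction to \<open>A\<close>.\<close>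
  define R where "R = (\<lambda>x w. x \<in> A \<and> w = f x)"
  have fD: "f x \<in> D" if "x \<in> A" for x using bij that by (auto dest: bij_betwE)
  have in_A: "\<exists>y\<in>A. w = f y" if "w \<in> D" for w using bij that by (auto simp: bij_betw_def)
  have down: "lower B (Op i) x = Some y \<and> y \<in> A \<longleftrightarrow> box_word_lower i (f x) = Some (f y) \<and> y \<in> A"
    if "i < n" "x \<in> A" for i x y
    using edge[of i x y] T_eq[of i "f x"] that fD by auto
  have down_A: "y \<in> A" if "i < n" "x \<in> A" "lower B (Op i) x = Some y" for i x y
    using that A(2) A(3)[of i x y] Op_closed(2)[of i x y] by auto
  have up_A: "y \<in> A" if "i < n" "x \<in> A" "raise B (Op i) x = Some y" for i x y
    using that A(2) A(3)[of i y x] Op_closed(1)[of i x y] Op_inverse[of i x y] by auto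
  have down_D: "w \<in> D" if "i < n" "x \<in> A" "box_word_lower i (f x) = Some w" for i x w
    using that D(2) D(3)[of i "f x" w] T_closed(2)[of i "f x" w] T_eq[of i "f x"] fD by auto
  have up_D: "w \<in> D" if "i < n" "x \<in> A" "box_word_raise i (f x) = Some w" for i x w
  proof -
    have w: "w \<in> carrier ?T" using T_closed(1)[of i "f x" w] that fD by auto
    moreover have "box_word_lower i w = Some (f x)"
      using that(3) box_words.up_iff_down by blast
    then have "lower ?T (Op i) w = Some (f x)" using T_eq'[OF that(1) w] by simp
    ultimately show ?thesis using D(3)[of i w "f x"] that fD D(2) by auto
  qed
  have up: "raise B (Op i) x = Some y \<longleftrightarrow> box_word_raise i (f x) = Some (f y)"
    if "i < n" "x \<in> A" "y \<in> A" for i x y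
  proof -
    have "raise B (Op i) x = Some y \<longleftrightarrow> lower B (Op i) y = Some x"
      using Op_inverse[of i x y] that A(2) by auto
    also have "\<dots> \<longleftrightarrow> box_word_lower i (f y) = Some (f x)"
      using down[of i y x] that by blast
    also have "\<dots> \<longleftrightarrow> box_word_raise i (f x) = Some (f y)"
      using box_words.up_iff_down by blast
    finally show ?thesis .
  qed
  have sim: "simulates R (raise B (Op i)) (box_word_raise i)" "simulates R (lower B (Op i)) (box_word_lower i)"
    if i: "i < n" for i
  proof -
    have "rel_option R (raise B (Op i) x) (box_word_raise i (f x))" if x: "x \<in> A" for x
    proof (cases "raise B (Op i) x")
      case None
      have "box_word_raise i (f x) = None"
      proof (rule ccontr)
        assume "box_word_raise i (f x) \<noteq> None"
        then obtain w where w: "box_word_raise i (f x) = Some w" by blast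
        then obtain y where "y \<in> A" "w = f y" using up_D[OF i x w] in_A by blast
        with w up[OF i x] None show False by auto
      qed
      with None show ?thesis by simp
    next
      case (Some y)
      then have "y \<in> A" "box_word_raise i (f x) = Some (f y)"
        using up_A[OF i x] up[OF i x] by blast+
      with Some show ?thesis by (simp add: R_def)
    qed
    then show "simulates R (raise B (Op i)) (box_word_raise i)" by (simp add: simulates_def R_def)
    have "rel_option R (lower B (Op i) x) (box_word_lower i (f x))" if x: "x \<in> A" for x
    proof (cases "lower B (Op i) x")
      case None
      have "box_word_lower i (f x) = None"
      proof (rule ccontr)
        assume "box_word_lower i (f x) \<noteq> None"
        then obtain w where w: "box_word_lower i (f x) = Some w" by blast
        then obtain y where "y \<in> A" "w = f y" using down_D[OF i x w] in_A by blast
        with w down[OF i x] None show False by auto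
      qed
      with None show ?thesis by simp
    next
      case (Some y)
      then have "y \<in> A" "box_word_lower i (f x) = Some (f y)"
        using down_A[OF i x] down[OF i x] by blast+
      with Some show ?thesis by (simp add: R_def)
    qed
    then show "simulates R (lower B (Op i)) (box_word_lower i)" by (simp add: simulates_def R_def)
  qed
  have "R (sigma B (Op i) x) (box_reflect i (f x))" if "i < n" "x \<in> A" for i x
    unfolding sigma_eq_reflect
    by (rule box_words.reflect_rel[OF sim(1)[OF that(1)] sim(2)[OF that(1)]]) (use that in \<open>simp add: R_def\<close>)
  then show thesis
    using that[of A f] bA A(2) bij by (simp add: R_def bij_betw_def)
qed

text \<open>
  The isomorphism is injective, so it suffices to compare the images of both sides in words of
  boxes.
\<close>
theorem sigma_relations:
  assumes "normal_q_plus_crystal n B"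
  shows "bc_relations n (\<lambda>i. sigma B (Op i)) (carrier B)"
proof
  fix i j b
  assume b: "b \<in> carrier B"
  obtain A f where A: "b \<in> A" "A \<subseteq> carrier B" "inj_on f A"
    "\<And>i x. \<lbrakk>i < n; x \<in> A\<rbrakk> \<Longrightarrow> sigma B (Op i) x \<in> A"
    "\<And>i x. \<lbrakk>i < n; x \<in> A\<rbrakk> \<Longrightarrow> f (sigma B (Op i) x) = box_reflect i (f x)"
    using normal_crystal_model[OF assms b] by blast
  have eqI: "x = y" if "f x = f y" "x \<in> A" "y \<in> A" for x y
    using A(3) that by (auto dest: inj_onD)
  show "sigma B (Op i) b \<in> carrier B" if "i < n"
    using A that by blast
  show "sigma B (Op i) (sigma B (Op i) b) = b" if "i < n"
    by (rule eqI) (simp_all add: A that box_words.reflect_reflect)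
  show "sigma B (Op i) (sigma B (Op j) b) = sigma B (Op j) (sigma B (Op i) b)" if "Suc i < j" "j < n"
    by (rule eqI) (use that in \<open>simp_all add: A box_reflect_commute[of i j]\<close>)
  show "sigma B (Op i) (sigma B (Op (Suc i)) (sigma B (Op i) b)) =
    sigma B (Op (Suc i)) (sigma B (Op i) (sigma B (Op (Suc i)) b))" if "1 \<le> i" "Suc i < n"
    by (rule eqI) (use that in \<open>simp_all add: A box_reflect_braid\<close>)
  show "sigma B (Op 0) (sigma B (Op 1) (sigma B (Op 0) (sigma B (Op 1) b))) =
    sigma B (Op 1) (sigma B (Op 0) (sigma B (Op 1) (sigma B (Op 0) b)))" if "1 < n"
    by (rule eqI) (use that box_reflect_quad in \<open>simp_all add: A\<close>)
qed

section \<open>The group action\<close>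

lemma (in group_action) action_mult:
  assumes "g \<in> carrier G" "h \<in> carrier G" "x \<in> E"
  shows "\<phi> (g \<otimes> h) x = \<phi> g (\<phi> h x)"
  using composition_rule assms by simp

text \<open>
  A signed permutation acts as any word that represents it. The action does not depend on the
  chosen word, because the relations present the group, and there is no other action, because
  every signed permutation has such a word.
\<close>
theorem bc_relations_action:
  assumes "bc_relations n s E"
  shows "\<exists>!\<rho>. \<rho> \<in> extensional (carrier (W_BC n)) \<and> group_action (W_BC n) E \<rho> \<and>
    (\<forall>i<n. \<forall>b\<in>E. \<rho> (BC_gen i) b = s i b)"
proof -
  interpret bc_relations n s E by (rule assms)
  interpret W: group "W_BC n" by (rule group_W_BC)
  define word where "word w = (SOME L. set L \<subseteq> {..<n} \<and> BC_eval L = w)" for w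
  have word: "set (word w) \<subseteq> {..<n}" "BC_eval (word w) = w" if "w \<in> carrier (W_BC n)" for w
    using someI_ex[OF W_generated[OF that]] by (simp_all add: word_def)
  define \<rho> where "\<rho> = (\<lambda>w\<in>carrier (W_BC n). \<lambda>b\<in>E. foldr s (word w) b)"
  have rho: "\<rho> (BC_eval L) = (\<lambda>b\<in>E. foldr s L b)" if "set L \<subseteq> {..<n}" for L
  proof -
    have "sim (word (BC_eval L)) L"
      using word[OF BC_eval_in_W[OF that]] that by (intro action_depends_only_on_permutation)
    then show ?thesis
      using BC_eval_in_W[OF that] by (auto simp: \<rho>_def sim_def fun_eq_iff restrict_def)
  qed
  have Bij: "(\<lambda>b\<in>E. foldr s L b) \<in> Bij E" if L: "set L \<subseteq> {..<n}" for L
  proof -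
    have "bij_betw (foldr s L) E E"
    proof (rule bij_betw_byWitness[where f' = "foldr s (rev L)"])
      show "\<forall>b\<in>E. foldr s (rev L) (foldr s L b) = b" "\<forall>b\<in>E. foldr s L (foldr s (rev L) b) = b"
        using sim_rev[of L] sim_rev[of "rev L"] L by (auto simp: sim_def)
    qed (use L foldr_closed[of L] foldr_closed[of "rev L"] in auto)
    then show ?thesis by (auto simp: Bij_def cong: bij_betw_cong)
  qed
  have hom: "\<rho> \<in> hom (W_BC n) (BijGroup E)"
  proof (rule homI)
    show "\<rho> w \<in> carrier (BijGroup E)" if "w \<in> carrier (W_BC n)" for w
      using rho[OF word(1)[OF that]] Bij[OF word(1)[OF that]] word(2)[OF that] by (simp add: BijGroup_def)
    fix v w assume v: "v \<in> carrier (W_BC n)" and w: "w \<in> carrier (W_BC n)"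
    have "v \<otimes>\<^bsub>W_BC n\<^esub> w = BC_eval (word v @ word w)"
      using word(2)[OF v] word(2)[OF w] by (simp add: W_BC_def fun_eq_iff)
    then have "\<rho> (v \<otimes>\<^bsub>W_BC n\<^esub> w) = (\<lambda>b\<in>E. foldr s (word v @ word w) b)"
      using rho[of "word v @ word w"] word(1)[OF v] word(1)[OF w] by simp
    also have "\<dots> = compose E (\<lambda>b\<in>E. foldr s (word v) b) (\<lambda>b\<in>E. foldr s (word w) b)"
      using foldr_closed[OF word(1)[OF w]] by (auto simp: compose_def fun_eq_iff restrict_def)
    also have "\<dots> = \<rho> v \<otimes>\<^bsub>BijGroup E\<^esub> \<rho> w"
      using rho[OF word(1)[OF v]] rho[OF word(1)[OF w]] Bij[OF word(1)[OF v]] Bij[OF word(1)[OF w]]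
        word(2)[OF v] word(2)[OF w] by (simp add: BijGroup_def)
    finally show "\<rho> (v \<otimes>\<^bsub>W_BC n\<^esub> w) = \<rho> v \<otimes>\<^bsub>BijGroup E\<^esub> \<rho> w" .
  qed
  show ?thesis
  proof (rule ex1I[of _ \<rho>])
    have "\<rho> (BC_gen i) b = s i b" if "i < n" "b \<in> E" for i b
      using rho[of "[i]"] that by (simp add: comp_def)
    moreover have "group_action (W_BC n) E \<rho>"
      using hom group_BijGroup by (intro group_action.intro group_hom.intro group_hom_axioms.intro W.is_group)
    ultimately show "\<rho> \<in> extensional (carrier (W_BC n)) \<and> group_action (W_BC n) E \<rho> \<and>
      (\<forall>i<n. \<forall>b\<in>E. \<rho> (BC_gen i) b = s i b)"
      by (simp add: \<rho>_def)
  next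
    fix \<tau> assume \<tau>: "\<tau> \<in> extensional (carrier (W_BC n)) \<and> group_action (W_BC n) E \<tau> \<and>
      (\<forall>i<n. \<forall>b\<in>E. \<tau> (BC_gen i) b = s i b)"
    interpret T: group_action "W_BC n" E \<tau> using \<tau> by blast
    have \<tau>_word: "\<tau> (BC_eval L) b = foldr s L b" if "set L \<subseteq> {..<n}" "b \<in> E" for L b
      using that
    proof (induction L)
      case Nil
      have one: "BC_eval [] = \<one>\<^bsub>W_BC n\<^esub>" by (simp add: W_BC_def fun_eq_iff)
      have "\<tau> (BC_eval []) b = b"
        unfolding one using fun_cong[OF T.id_eq_one, of b] Nil by simp
      then show ?case by (simp add: id_def)
    next
      case (Cons i L)
      have i: "BC_gen i \<in> carrier (W_BC n)" and L: "BC_eval L \<in> carrier (W_BC n)"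
        using BC_eval_in_W[of "[i]" n] BC_eval_in_W[of L n] Cons.prems(1) by (auto simp: comp_def)
      have "BC_eval (i # L) = BC_gen i \<otimes>\<^bsub>W_BC n\<^esub> BC_eval L" by (simp add: W_BC_def comp_def)
      then have "\<tau> (BC_eval (i # L)) b = \<tau> (BC_gen i) (\<tau> (BC_eval L) b)"
        using T.action_mult[OF i L Cons.prems(2)] by simp
      then show ?case using Cons \<tau> foldr_closed[of L b] by (simp add: comp_def)
    qed
    show "\<tau> = \<rho>"
    proof (rule extensionalityI[of _ "carrier (W_BC n)"])
      fix w assume w: "w \<in> carrier (W_BC n)"
      show "\<tau> w = \<rho> w"
      proof (rule extensionalityI[of _ E])
        show "\<tau> w \<in> extensional E" using T.bij_prop0[OF w] by (simp add: Bij_def)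
        show "\<rho> w \<in> extensional E" using w by (simp add: \<rho>_def)
        show "\<tau> w b = \<rho> w b" if "b \<in> E" for b
          using \<tau>_word[OF word(1)[OF w] that] rho[OF word(1)[OF w]] word(2)[OF w] that by simp
      qed
    qed (use \<tau> in \<open>simp_all add: \<rho>_def\<close>)
  qed
qed

theorem theorem4p8:
  fixes n :: nat and B :: "'b crystal"
  assumes "n \<ge> 1"
    and "normal_q_plus_crystal n B"
  shows "\<exists>!\<rho>. \<rho> \<in> extensional (carrier (W_BC n)) \<and>
           group_action (W_BC n) (carrier B) \<rho> \<and>
           (\<forall>i<n. \<forall>b\<in>carrier B. \<rho> (BC_gen i) b = sigma B (Op i) b)"
  using bc_relations_action[OF sigma_relations[OF assms(2)]] .

end
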